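(* Let $(\mathcal{C}_1,\mathcal{X},\mathcal{C}_2)$ be a prile of one-sided triangulated categories, where $\mathcal{C}_1=(\mathcal{C}_1,\Omega,\triangle)$ is a left triangulated category, $\mathcal{C}_2=(\mathcal{C}_2,\Sigma,\bigtriangledown)$ is a right triangulated category, $i:\mathcal{X}\to\mathcal{C}_1$ is the left coreflective functor with coreflector $Q$, and $j:\mathcal{X}\to\mathcal{C}_2$ is the right reflective functor with reflector $R$. Then $\mathcal{X}$ inherits a pretriangulated structure from $\mathcal{C}_1$ and $\mathcal{C}_2$; that is, $(R\Sigma j,\ Q\Omega i,\ \triangle_{\mathcal{X}},\ \bigtriangledown_{\mathcal{X}})$ is a pretriangulated structure on $\mathcal{X}$.
   Context: **Left triangulated structure.** Let $\mathcal{C}$ be an additive category with an additive endofunctor $\Omega$. A left triangle is a diagram $\Omega(A)\xrightarrow{h}C\xrightarrow{g}B\xrightarrow{f}A$; a morphism from it to $\Omega(A')\xrightarrow{h'}C'\xrightarrow{g'}B'\xrightarrow{f'}A'$ is a triple $(\gamma:C\to C',\beta:B\to B',\alpha:A\to A')$ with $\gamma h=h'\Omega(\alpha)$, $\beta g=g'\gamma$, $\alpha f=f'\beta$. A class $\triangle$ of left triangles gives a left triangulated structure $(\Omega,\triangle)$ if $\triangle$ is closed under isomorphism and: (LT1) every $f:B\to A$ fits in some $\Omega(A)\to C\to B\xrightarrow{f}A$ in $\triangle$, and $0\to A\xrightarrow{1_A}A\to 0$ is in $\triangle$ for all $A$; (LT2) if $\Omega(A)\xrightarrow{h}C\xrightarrow{g}B\xrightarrow{f}A$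 is in $\triangle$ then so is $\Omega(B)\xrightarrow{-\Omega(f)}\Omega(A)\xrightarrow{h}C\xrightarrow{g}B$; (LT3) given two triangles $\Omega(A)\xrightarrow{h}C\xrightarrow{g}B\xrightarrow{f}A$ and $\Omega(A')\xrightarrow{h'}C'\xrightarrow{g'}B'\xrightarrow{f'}A'$ in $\triangle$ and $\beta:B\to B'$, $\alpha:A\to A'$ with $\alpha f=f'\beta$, there is $\gamma:C\to C'$ making $(\gamma,\beta,\alpha)$ a morphism of left triangles; (LT4) given $g:C\to B$ and $f:B\to A$, there are triangles $\Omega(B)\xrightarrow{m}D\xrightarrow{k}C\xrightarrow{g}B$, $\Omega(A)\xrightarrow{n}E\xrightarrow{h}C\xrightarrow{fg}A$, $\Omega(A)\xrightarrow{i}F\xrightarrow{l}B\xrightarrow{f}A$ in $\triangle$ and morphisms $\alpha:D\to E$, $\beta:E\to F$ with $\alpha m=n\Omega(f)$, $h\alpha=k$, $\beta n=i$, $l\beta=gh$, such that $\Omega(F)\xrightarrow{m\Omega(l)}D\xrightarrow{\alpha}E\xrightarrow{\beta}F$ is in $\triangle$. A left triangulated category is a triple $(\mathcal{C},\Omega,\triangle)$. Right triangulated structures $(\Sigma,\bigtriangledown)$, with right triangles $A\to B\to C\to\Sigma(A)$, and right triangulated categories are defined dually (i.e. the opposite data on the opposite category is left triangulated). **Left coreflective functor.** Let $(\mathcal{C},\Omega,\triangle)$ be left triangulated and $\mathcal{X}$ additive. A fully faithful functor $i:\mathcal{X}\to\mathcal{C}$ is left coreflective if: (a) it has a right adjoint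 $Q$ (the coreflector); (b) for every $f:B\to A$ in $\mathcal{C}$ and left triangles $\Omega(A)\to C\to B\xrightarrow{f}A$ and $\Omega iQ(A)\to D\to iQ(B)\xrightarrow{iQ(f)}iQ(A)$ in $\triangle$, if $t:D\to C$ is a morphism provided by (LT3) such that $(t,\varepsilon_B,\varepsilon_A)$ is a morphism from the second triangle to the first ($\varepsilon:iQ\to\mathrm{id}$ the counit), then $Q(t)$ is an isomorphism. A right reflective functor $j:\mathcal{Y}\to\mathcal{D}$ into a right triangulated category is defined dually; its left adjoint $R$ is the reflector. **Induced triangles.** For $i$ left coreflective, with unit isomorphism $\eta:\mathrm{id}_{\mathcal{X}}\to Qi$, $\triangle_{\mathcal{X}}$ is the class of left triangles in $\mathcal{X}$ (with respect to the endofunctor $Q\Omega i$) isomorphic to $Q\Omega i(A)\xrightarrow{Q(h)}Q(C)\xrightarrow{\eta_B^{-1}Q(g)}B\xrightarrow{f}A$ for some $f:B\to A$ in $\mathcal{X}$ and some $\Omega i(A)\xrightarrow{h}C\xrightarrow{g}i(B)\xrightarrow{i(f)}i(A)$ in $\triangle$. Dually, for $j$ right reflective, with counit isomorphism $\theta:Rj\to\mathrm{id}$, $\bigtriangledown_{\mathcal{X}}$ is the class of right triangles (with respect to $R\Sigma j$) isomorphic to $A\xrightarrow{f}B\xrightarrow{R(g)\theta_B^{-1}}R(C)\xrightarrow{R(h)}R\Sigma j(A)$ for some $j(A)\xrightarrow{j(f)}j(B)\xrightarrow{g}C\xrightarrow{h}\Sigma j(A)$ in $\bigtriangledown$. **Prile.**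 Let $\mathcal{C}_1=(\mathcal{C}_1,\Omega,\triangle)$ be left triangulated, $\mathcal{C}_2=(\mathcal{C}_2,\Sigma,\bigtriangledown)$ right triangulated, $\mathcal{X}$ additive, $i:\mathcal{X}\to\mathcal{C}_1$ left coreflective with coreflector $Q$, $j:\mathcal{X}\to\mathcal{C}_2$ right reflective with reflector $R$. The triple $(\mathcal{C}_1,\mathcal{X},\mathcal{C}_2)$ is a prile of one-sided triangulated categories if: (i) $(R\Sigma j,Q\Omega i)$ is an adjoint pair of endofunctors of $\mathcal{X}$ ($R\Sigma j$ left adjoint), with unit $\eta$ and counit $\varepsilon$; (ii) for any $Q\Omega i(A)\xrightarrow{h}C\xrightarrow{g'}D\xrightarrow{f'}R\Sigma jQ\Omega i(A)$ in $\bigtriangledown_{\mathcal{X}}$ and $Q\Omega i(A)\xrightarrow{h}C\xrightarrow{g}B\xrightarrow{f}A$ in $\triangle_{\mathcal{X}}$ there is $s:D\to B$ with $sg'=g$ and $fs=\varepsilon_Af'$; (iii) for any $X\xrightarrow{l}Y\xrightarrow{m}Z\xrightarrow{n}R\Sigma j(X)$ in $\bigtriangledown_{\mathcal{X}}$ and $Q\Omega iR\Sigma j(X)\xrightarrow{l'}U\xrightarrow{m'}Z\xrightarrow{n}R\Sigma j(X)$ in $\triangle_{\mathcal{X}}$ there is $t:Y\to U$ with $tl=l'\eta_X$ and $m't=m$. **Pretriangulated structure.** A pretriangulated structure on an additive category $\mathcal{C}$ is a quadruple $(\Sigma,\Omega,\triangle,\bigtriangledown)$ such that: (i) $(\Sigma,\Omega)$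 is an adjoint pair ($\Sigma$ left adjoint) with unit $\eta$, counit $\varepsilon$; (ii) $(\Omega,\triangle)$ is a left triangulated structure and $(\Sigma,\bigtriangledown)$ a right triangulated structure on $\mathcal{C}$; (iii) for $A\xrightarrow{f}B\xrightarrow{g}C\xrightarrow{h}\Sigma(A)$ in $\bigtriangledown$, $\Omega(C')\xrightarrow{f'}A'\xrightarrow{g'}B'\xrightarrow{h'}C'$ in $\triangle$, and $\alpha:A\to\Omega(C')$, $\beta:B\to A'$ with $\beta f=f'\alpha$, there is $\delta:C\to B'$ with $\delta g=g'\beta$ and $h'\delta=\varepsilon_{C'}\Sigma(\alpha)h$; (iv) for two such triangles and $\alpha:\Sigma(A)\to C'$, $\beta:C\to B'$ with $h'\beta=\alpha h$, there is $\delta:B\to A'$ with $\delta f=f'\Omega(\alpha)\eta_A$ and $g'\delta=\beta g$. *)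

theory Defs
  imports "HOL-Algebra.Group"
begin

section \<open>Additive categories and functors\<close>

text \<open>
  Categories are carried by a set of objects and a set of arrows, with total functions for
  domain, codomain, identities and composition that are only constrained on these sets.
  The fields \<open>Add\<close> and \<open>Zero\<close> hold the group structure of the hom-sets.
\<close>

record ('o, 'm) cat =
  Ob :: "'o set"
  Arr :: "'m set"
  Dom :: "'m \<Rightarrow> 'o"
  Cod :: "'m \<Rightarrow> 'o"
  Ide :: "'o \<Rightarrow> 'm"
  Comp :: "'m \<Rightarrow> 'm \<Rightarrow> 'm" (infixl "\<cdot>\<index>" 70)
  Add :: "'m \<Rightarrow> 'm \<Rightarrow> 'm" (infixl "\<oplus>\<index>" 65)
  Zero :: "'o \<Rightarrow> 'o \<Rightarrow> 'm"

definition Hom :: "('o, 'm) cat \<Rightarrow> 'o \<Rightarrow> 'o \<Rightarrow> 'm set" where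
  "Hom C A B = {f \<in> Arr C. Dom C f = A \<and> Cod C f = B}"

locale category =
  fixes C :: "('o, 'm) cat" (structure)
  assumes Dom_in_Ob: "f \<in> Arr C \<Longrightarrow> Dom C f \<in> Ob C"
    and Cod_in_Ob: "f \<in> Arr C \<Longrightarrow> Cod C f \<in> Ob C"
    and Ide_in_Hom: "A \<in> Ob C \<Longrightarrow> Ide C A \<in> Hom C A A"
    and Comp_in_Hom: "\<lbrakk>f \<in> Hom C A B; g \<in> Hom C B D\<rbrakk> \<Longrightarrow> g \<cdot> f \<in> Hom C A D"
    and Comp_Ide_left: "f \<in> Hom C A B \<Longrightarrow> Ide C B \<cdot> f = f"
    and Comp_Ide_right: "f \<in> Hom C A B \<Longrightarrow> f \<cdot> Ide C A = f"
    and Comp_assoc: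
      "\<lbrakk>f \<in> Hom C A B; g \<in> Hom C B D; h \<in> Hom C D E\<rbrakk> \<Longrightarrow> h \<cdot> g \<cdot> f = h \<cdot> (g \<cdot> f)"

definition is_iso :: "('o, 'm) cat \<Rightarrow> 'm \<Rightarrow> bool" where
  "is_iso C f \<longleftrightarrow> f \<in> Arr C \<and>
    (\<exists>g \<in> Hom C (Cod C f) (Dom C f).
      g \<cdot>\<^bsub>C\<^esub> f = Ide C (Dom C f) \<and> f \<cdot>\<^bsub>C\<^esub> g = Ide C (Cod C f))"

definition arr_inv :: "('o, 'm) cat \<Rightarrow> 'm \<Rightarrow> 'm" where
  "arr_inv C f = (THE g. g \<in> Hom C (Cod C f) (Dom C f) \<and>
    g \<cdot>\<^bsub>C\<^esub> f = Ide C (Dom C f) \<and> f \<cdot>\<^bsub>C\<^esub> g = Ide C (Cod C f))"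

text \<open>The group \<open>Hom(A, B)\<close>; its product is the addition of arrows.\<close>

definition hom_group :: "('o, 'm) cat \<Rightarrow> 'o \<Rightarrow> 'o \<Rightarrow> 'm monoid" where
  "hom_group C A B = \<lparr>carrier = Hom C A B, monoid.mult = Add C, one = Zero C A B\<rparr>"

definition arr_minus :: "('o, 'm) cat \<Rightarrow> 'm \<Rightarrow> 'm" where
  "arr_minus C f = inv\<^bsub>hom_group C (Dom C f) (Cod C f)\<^esub> f"

definition zero_object :: "('o, 'm) cat \<Rightarrow> 'o \<Rightarrow> bool" where
  "zero_object C Z \<longleftrightarrow> Z \<in> Ob C \<and>
    (\<forall>A \<in> Ob C. (\<exists>!f. f \<in> Hom C A Z) \<and> (\<exists>!f. f \<in> Hom C Z A))"

locale additive_category = category +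
  assumes comm_group_Hom: "\<lbrakk>A \<in> Ob C; B \<in> Ob C\<rbrakk> \<Longrightarrow> comm_group (hom_group C A B)"
    and Comp_Add_right:
      "\<lbrakk>f \<in> Hom C A B; f' \<in> Hom C A B; g \<in> Hom C B D\<rbrakk> \<Longrightarrow> g \<cdot> (f \<oplus> f') = g \<cdot> f \<oplus> g \<cdot> f'"
    and Comp_Add_left:
      "\<lbrakk>f \<in> Hom C A B; g \<in> Hom C B D; g' \<in> Hom C B D\<rbrakk> \<Longrightarrow> (g \<oplus> g') \<cdot> f = g \<cdot> f \<oplus> g' \<cdot> f"
    and ex_zero_object: "\<exists>Z. zero_object C Z"
    and ex_biproduct: "\<lbrakk>A \<in> Ob C; B \<in> Ob C\<rbrakk> \<Longrightarrow>
      \<exists>P \<in> Ob C. \<exists>\<iota>\<^sub>1 \<in> Hom C A P. \<exists>\<iota>\<^sub>2 \<in> Hom C B P. \<exists>\<pi>\<^sub>1 \<in> Hom C P A. \<exists>\<pi>\<^sub>2 \<in> Hom C P B.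
        \<pi>\<^sub>1 \<cdot> \<iota>\<^sub>1 = Ide C A \<and> \<pi>\<^sub>2 \<cdot> \<iota>\<^sub>2 = Ide C B \<and>
        \<pi>\<^sub>1 \<cdot> \<iota>\<^sub>2 = Zero C B A \<and> \<pi>\<^sub>2 \<cdot> \<iota>\<^sub>1 = Zero C A B \<and>
        \<iota>\<^sub>1 \<cdot> \<pi>\<^sub>1 \<oplus> \<iota>\<^sub>2 \<cdot> \<pi>\<^sub>2 = Ide C P"

definition op_cat :: "('o, 'm) cat \<Rightarrow> ('o, 'm) cat" where
  "op_cat C = \<lparr>Ob = Ob C, Arr = Arr C, Dom = Cod C, Cod = Dom C, Ide = Ide C,
    Comp = (\<lambda>g f. f \<cdot>\<^bsub>C\<^esub> g), Add = Add C, Zero = (\<lambda>A B. Zero C B A)\<rparr>"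

text \<open>
  Functor data does not mention source and target, so the same record also serves as the
  opposite functor between the opposite categories.
\<close>

record ('o, 'm, 'p, 'q) cat_fun =
  FOb :: "'o \<Rightarrow> 'p"
  FArr :: "'m \<Rightarrow> 'q"

definition id_fun :: "('o, 'm, 'o, 'm) cat_fun" where
  "id_fun = \<lparr>FOb = (\<lambda>A. A), FArr = (\<lambda>f. f)\<rparr>"

definition comp_fun ::
    "('p, 'q, 'r, 's) cat_fun \<Rightarrow> ('o, 'm, 'p, 'q) cat_fun \<Rightarrow> ('o, 'm, 'r, 's) cat_fun"
    (infixl "\<circ>\<^sub>F" 75) where
  "G \<circ>\<^sub>F F = \<lparr>FOb = FOb G \<circ> FOb F, FArr = FArr G \<circ> FArr F\<rparr>"

locale cat_functor = src: category C + tgt: category D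
  for C :: "('o, 'm) cat" and D :: "('p, 'q) cat" +
  fixes F :: "('o, 'm, 'p, 'q) cat_fun"
  assumes FOb_in_Ob: "A \<in> Ob C \<Longrightarrow> FOb F A \<in> Ob D"
    and FArr_in_Hom: "f \<in> Hom C A B \<Longrightarrow> FArr F f \<in> Hom D (FOb F A) (FOb F B)"
    and FArr_Ide: "A \<in> Ob C \<Longrightarrow> FArr F (Ide C A) = Ide D (FOb F A)"
    and FArr_Comp: "\<lbrakk>f \<in> Hom C A B; g \<in> Hom C B E\<rbrakk> \<Longrightarrow>
      FArr F (g \<cdot>\<^bsub>C\<^esub> f) = FArr F g \<cdot>\<^bsub>D\<^esub> FArr F f"

locale additive_functor = cat_functor +
  assumes FArr_Add: "\<lbrakk>f \<in> Hom C A B; g \<in> Hom C A B\<rbrakk> \<Longrightarrow>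
      FArr F (f \<oplus>\<^bsub>C\<^esub> g) = FArr F f \<oplus>\<^bsub>D\<^esub> FArr F g"

definition fully_faithful ::
    "('o, 'm) cat \<Rightarrow> ('p, 'q) cat \<Rightarrow> ('o, 'm, 'p, 'q) cat_fun \<Rightarrow> bool" where
  "fully_faithful C D F \<longleftrightarrow> cat_functor C D F \<and>
    (\<forall>A \<in> Ob C. \<forall>B \<in> Ob C. bij_betw (FArr F) (Hom C A B) (Hom D (FOb F A) (FOb F B)))"

locale nat_trans = F: cat_functor C D F + G: cat_functor C D G
  for C :: "('o, 'm) cat" and D :: "('p, 'q) cat"
    and F G :: "('o, 'm, 'p, 'q) cat_fun" +
  fixes \<tau> :: "'o \<Rightarrow> 'q"
  assumes component_in_Hom: "A \<in> Ob C \<Longrightarrow> \<tau> A \<in> Hom D (FOb F A) (FOb G A)"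
    and naturality: "f \<in> Hom C A B \<Longrightarrow> \<tau> B \<cdot>\<^bsub>D\<^esub> FArr F f = FArr G f \<cdot>\<^bsub>D\<^esub> \<tau> A"

text \<open>\<open>F : C \<rightarrow> D\<close> is left adjoint to \<open>G : D \<rightarrow> C\<close> with unit \<open>\<eta>\<close> and counit \<open>\<epsilon>\<close>.\<close>

locale adjunction =
  F: cat_functor C D F + G: cat_functor D C G +
  unit: nat_trans C C id_fun "G \<circ>\<^sub>F F" \<eta> + counit: nat_trans D D "F \<circ>\<^sub>F G" id_fun \<epsilon>
  for C :: "('o, 'm) cat" and D :: "('p, 'q) cat"
    and F :: "('o, 'm, 'p, 'q) cat_fun" and G :: "('p, 'q, 'o, 'm) cat_fun"
    and \<eta> :: "'o \<Rightarrow> 'm" and \<epsilon> :: "'p \<Rightarrow> 'q" +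
  assumes triangle_F: "A \<in> Ob C \<Longrightarrow> \<epsilon> (FOb F A) \<cdot>\<^bsub>D\<^esub> FArr F (\<eta> A) = Ide D (FOb F A)"
    and triangle_G: "B \<in> Ob D \<Longrightarrow> FArr G (\<epsilon> B) \<cdot>\<^bsub>C\<^esub> \<eta> (FOb G B) = Ide C (FOb G B)"


section \<open>One-sided triangulated categories\<close>

text \<open>
  A diagram of three composable arrows is stored as the triple of its arrows from left to right;
  the objects are recovered as domains and codomains. A left triangle
  \<open>\<Omega>(A) \<rightarrow> C \<rightarrow> B \<rightarrow> A\<close> with arrows \<open>h, g, f\<close> is \<open>(h, g, f)\<close>, and a right triangle
  \<open>A \<rightarrow> B \<rightarrow> C \<rightarrow> \<Sigma>(A)\<close> with arrows \<open>f, g, h\<close> is \<open>(f, g, h)\<close>.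
\<close>

type_synonym 'm tri = "'m \<times> 'm \<times> 'm"

fun left_triangle :: "('o, 'm) cat \<Rightarrow> ('o, 'm, 'o, 'm) cat_fun \<Rightarrow> 'm tri \<Rightarrow> bool" where
  "left_triangle C \<Omega> (h, g, f) \<longleftrightarrow> h \<in> Arr C \<and> g \<in> Arr C \<and> f \<in> Arr C \<and>
    Dom C h = FOb \<Omega> (Cod C f) \<and> Cod C h = Dom C g \<and> Cod C g = Dom C f"

fun left_triangle_mor ::
    "('o, 'm) cat \<Rightarrow> ('o, 'm, 'o, 'm) cat_fun \<Rightarrow> 'm tri \<Rightarrow> 'm tri \<Rightarrow> 'm tri \<Rightarrow> bool" where
  "left_triangle_mor C \<Omega> (h, g, f) (h', g', f') (\<gamma>, \<beta>, \<alpha>) \<longleftrightarrow>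
    left_triangle C \<Omega> (h, g, f) \<and> left_triangle C \<Omega> (h', g', f') \<and>
    \<gamma> \<in> Hom C (Dom C g) (Dom C g') \<and>
    \<beta> \<in> Hom C (Dom C f) (Dom C f') \<and>
    \<alpha> \<in> Hom C (Cod C f) (Cod C f') \<and>
    \<gamma> \<cdot>\<^bsub>C\<^esub> h = h' \<cdot>\<^bsub>C\<^esub> FArr \<Omega> \<alpha> \<and> \<beta> \<cdot>\<^bsub>C\<^esub> g = g' \<cdot>\<^bsub>C\<^esub> \<gamma> \<and> \<alpha> \<cdot>\<^bsub>C\<^esub> f = f' \<cdot>\<^bsub>C\<^esub> \<beta>"

definition left_triangle_iso ::
    "('o, 'm) cat \<Rightarrow> ('o, 'm, 'o, 'm) cat_fun \<Rightarrow> 'm tri \<Rightarrow> 'm tri \<Rightarrow> bool" where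
  "left_triangle_iso C \<Omega> t t' \<longleftrightarrow> (\<exists>\<gamma> \<beta> \<alpha>.
    left_triangle_mor C \<Omega> t t' (\<gamma>, \<beta>, \<alpha>) \<and> is_iso C \<gamma> \<and> is_iso C \<beta> \<and> is_iso C \<alpha>)"

fun right_triangle :: "('o, 'm) cat \<Rightarrow> ('o, 'm, 'o, 'm) cat_fun \<Rightarrow> 'm tri \<Rightarrow> bool" where
  "right_triangle C \<Sigma> (f, g, h) \<longleftrightarrow> f \<in> Arr C \<and> g \<in> Arr C \<and> h \<in> Arr C \<and>
    Cod C f = Dom C g \<and> Cod C g = Dom C h \<and> Cod C h = FOb \<Sigma> (Dom C f)"

fun right_triangle_mor ::
    "('o, 'm) cat \<Rightarrow> ('o, 'm, 'o, 'm) cat_fun \<Rightarrow> 'm tri \<Rightarrow> 'm tri \<Rightarrow> 'm tri \<Rightarrow> bool" where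
  "right_triangle_mor C \<Sigma> (f, g, h) (f', g', h') (\<alpha>, \<beta>, \<gamma>) \<longleftrightarrow>
    right_triangle C \<Sigma> (f, g, h) \<and> right_triangle C \<Sigma> (f', g', h') \<and>
    \<alpha> \<in> Hom C (Dom C f) (Dom C f') \<and>
    \<beta> \<in> Hom C (Cod C f) (Cod C f') \<and>
    \<gamma> \<in> Hom C (Cod C g) (Cod C g') \<and>
    \<beta> \<cdot>\<^bsub>C\<^esub> f = f' \<cdot>\<^bsub>C\<^esub> \<alpha> \<and> \<gamma> \<cdot>\<^bsub>C\<^esub> g = g' \<cdot>\<^bsub>C\<^esub> \<beta> \<and> FArr \<Sigma> \<alpha> \<cdot>\<^bsub>C\<^esub> h = h' \<cdot>\<^bsub>C\<^esub> \<gamma>"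

definition right_triangle_iso ::
    "('o, 'm) cat \<Rightarrow> ('o, 'm, 'o, 'm) cat_fun \<Rightarrow> 'm tri \<Rightarrow> 'm tri \<Rightarrow> bool" where
  "right_triangle_iso C \<Sigma> t t' \<longleftrightarrow> (\<exists>\<alpha> \<beta> \<gamma>.
    right_triangle_mor C \<Sigma> t t' (\<alpha>, \<beta>, \<gamma>) \<and> is_iso C \<alpha> \<and> is_iso C \<beta> \<and> is_iso C \<gamma>)"

text \<open>
  In \<open>LT1_Ide\<close> the leftmost object of \<open>0 \<rightarrow> A \<rightarrow> A \<rightarrow> 0\<close> is \<open>\<Omega>(Z)\<close> for the zero object \<open>Z\<close>
  on the right; it is a zero object because \<open>\<Omega>\<close> is additive.
\<close>

locale left_triangulated = additive_category C + shift: additive_functor C C \<Omega>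
  for C :: "('o, 'm) cat" (structure) and \<Omega> :: "('o, 'm, 'o, 'm) cat_fun" +
  fixes \<L> :: "'m tri set"
  assumes left_triangles: "t \<in> \<L> \<Longrightarrow> left_triangle C \<Omega> t"
    and iso_closed: "\<lbrakk>t \<in> \<L>; left_triangle_iso C \<Omega> t t'\<rbrakk> \<Longrightarrow> t' \<in> \<L>"
    and LT1_ex: "f \<in> Arr C \<Longrightarrow> \<exists>h g. (h, g, f) \<in> \<L>"
    and LT1_Ide: "\<lbrakk>A \<in> Ob C; zero_object C Z\<rbrakk> \<Longrightarrow>
      (Zero C (FOb \<Omega> Z) A, Ide C A, Zero C A Z) \<in> \<L>"
    and LT2: "(h, g, f) \<in> \<L> \<Longrightarrow> (arr_minus C (FArr \<Omega> f), h, g) \<in> \<L>"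
    and LT3: "\<lbrakk>(h, g, f) \<in> \<L>; (h', g', f') \<in> \<L>;
      \<beta> \<in> Hom C (Dom C f) (Dom C f'); \<alpha> \<in> Hom C (Cod C f) (Cod C f'); \<alpha> \<cdot> f = f' \<cdot> \<beta>\<rbrakk> \<Longrightarrow>
      \<exists>\<gamma>. left_triangle_mor C \<Omega> (h, g, f) (h', g', f') (\<gamma>, \<beta>, \<alpha>)"
    and LT4: "\<lbrakk>g \<in> Arr C; f \<in> Arr C; Cod C g = Dom C f\<rbrakk> \<Longrightarrow>
      \<exists>m k n h i l. (m, k, g) \<in> \<L> \<and> (n, h, f \<cdot> g) \<in> \<L> \<and> (i, l, f) \<in> \<L> \<and>
        (\<exists>\<alpha> \<in> Hom C (Dom C k) (Dom C h). \<exists>\<beta> \<in> Hom C (Dom C h) (Dom C l).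
          \<alpha> \<cdot> m = n \<cdot> FArr \<Omega> f \<and> h \<cdot> \<alpha> = k \<and> \<beta> \<cdot> n = i \<and> l \<cdot> \<beta> = g \<cdot> h \<and>
          (m \<cdot> FArr \<Omega> l, \<alpha>, \<beta>) \<in> \<L>)"

definition op_triangles :: "'m tri set \<Rightarrow> 'm tri set" where
  "op_triangles T = {(h, g, f). (f, g, h) \<in> T}"

definition right_triangulated ::
    "('o, 'm) cat \<Rightarrow> ('o, 'm, 'o, 'm) cat_fun \<Rightarrow> 'm tri set \<Rightarrow> bool" where
  "right_triangulated C \<Sigma> \<R> \<longleftrightarrow> left_triangulated (op_cat C) \<Sigma> (op_triangles \<R>)"


section \<open>Coreflective and reflective functors, induced triangles\<close>

text \<open>
  The parameters \<open>Q\<close>, \<open>\<eta>\<close>, \<open>\<epsilon>\<close> are the coreflector and the unit and counit of the adjunction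
  with left adjoint \<open>i\<close>. Functors between \<open>X\<close> and \<open>C\<close> are not assumed additive: adjoint functors
  between additive categories are.
\<close>

locale left_coreflective =
  left_triangulated C \<Omega> \<L> + sub: additive_category X + adj: adjunction X C i Q \<eta> \<epsilon>
  for C :: "('o, 'm) cat" and \<Omega> :: "('o, 'm, 'o, 'm) cat_fun" and \<L> :: "'m tri set"
    and X :: "('x, 'p) cat" and i :: "('x, 'p, 'o, 'm) cat_fun"
    and Q :: "('o, 'm, 'x, 'p) cat_fun" and \<eta> :: "'x \<Rightarrow> 'p" and \<epsilon> :: "'o \<Rightarrow> 'm" +
  assumes fully_faithful: "fully_faithful X C i"
    and coreflective: "\<lbrakk>(h, g, f) \<in> \<L>; (h', g', FArr i (FArr Q f)) \<in> \<L>;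
      left_triangle_mor C \<Omega> (h', g', FArr i (FArr Q f)) (h, g, f)
        (t, \<epsilon> (Dom C f), \<epsilon> (Cod C f))\<rbrakk> \<Longrightarrow> is_iso X (FArr Q t)"

text \<open>
  Here \<open>R\<close> is left adjoint to \<open>j\<close>, with unit \<open>\<rho> : id \<rightarrow> jR\<close> and counit \<open>\<theta> : Rj \<rightarrow> id\<close>. Passing to the
  opposite categories makes \<open>R\<close> right adjoint to \<open>j\<close> and exchanges unit and counit.
\<close>

definition right_reflective ::
    "('o, 'm) cat \<Rightarrow> ('o, 'm, 'o, 'm) cat_fun \<Rightarrow> 'm tri set \<Rightarrow> ('x, 'p) cat \<Rightarrow>
     ('x, 'p, 'o, 'm) cat_fun \<Rightarrow> ('o, 'm, 'x, 'p) cat_fun \<Rightarrow> ('o \<Rightarrow> 'm) \<Rightarrow> ('x \<Rightarrow> 'p) \<Rightarrow> bool" where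
  "right_reflective C \<Sigma> \<R> X j R \<rho> \<theta> \<longleftrightarrow>
    left_coreflective (op_cat C) \<Sigma> (op_triangles \<R>) (op_cat X) j R \<theta> \<rho>"

definition induced_left_triangles ::
    "('o, 'm, 'o, 'm) cat_fun \<Rightarrow> 'm tri set \<Rightarrow> ('x, 'p) cat \<Rightarrow>
     ('x, 'p, 'o, 'm) cat_fun \<Rightarrow> ('o, 'm, 'x, 'p) cat_fun \<Rightarrow> ('x \<Rightarrow> 'p) \<Rightarrow> 'p tri set" where
  "induced_left_triangles \<Omega> \<L> X i Q \<eta> = {t. \<exists>h g f. f \<in> Arr X \<and> (h, g, FArr i f) \<in> \<L> \<and>
    left_triangle_iso X (Q \<circ>\<^sub>F \<Omega> \<circ>\<^sub>F i) t
      (FArr Q h, arr_inv X (\<eta> (Dom X f)) \<cdot>\<^bsub>X\<^esub> FArr Q g, f)}"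

definition induced_right_triangles ::
    "('o, 'm, 'o, 'm) cat_fun \<Rightarrow> 'm tri set \<Rightarrow> ('x, 'p) cat \<Rightarrow>
     ('x, 'p, 'o, 'm) cat_fun \<Rightarrow> ('o, 'm, 'x, 'p) cat_fun \<Rightarrow> ('x \<Rightarrow> 'p) \<Rightarrow> 'p tri set" where
  "induced_right_triangles \<Sigma> \<R> X j R \<theta> = {t. \<exists>f g h. f \<in> Arr X \<and> (FArr j f, g, h) \<in> \<R> \<and>
    right_triangle_iso X (R \<circ>\<^sub>F \<Sigma> \<circ>\<^sub>F j) t
      (f, FArr R g \<cdot>\<^bsub>X\<^esub> arr_inv X (\<theta> (Cod X f)), FArr R h)}"


section \<open>Priles and pretriangulated structures\<close>

text \<open>
  \<open>\<eta>\<^sub>i\<close>, \<open>\<epsilon>\<^sub>i\<close> belong to the adjunction between \<open>i\<close> and \<open>Q\<close>; \<open>\<rho>\<close>, \<open>\<theta>\<close> to the one between \<open>R\<close> and \<open>j\<close>;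
  \<open>\<eta>\<close>, \<open>\<epsilon>\<close> to the one between the endofunctors \<open>R\<Sigma>j\<close> and \<open>Q\<Omega>i\<close> of \<open>X\<close>.
\<close>

locale prile =
  fixes C\<^sub>1 :: "('o1, 'm1) cat" and \<Omega> :: "('o1, 'm1, 'o1, 'm1) cat_fun" and \<L> :: "'m1 tri set"
    and X :: "('x, 'p) cat"
    and C\<^sub>2 :: "('o2, 'm2) cat" and \<Sigma> :: "('o2, 'm2, 'o2, 'm2) cat_fun" and \<R> :: "'m2 tri set"
    and i :: "('x, 'p, 'o1, 'm1) cat_fun" and Q :: "('o1, 'm1, 'x, 'p) cat_fun"
    and \<eta>\<^sub>i :: "'x \<Rightarrow> 'p" and \<epsilon>\<^sub>i :: "'o1 \<Rightarrow> 'm1"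
    and j :: "('x, 'p, 'o2, 'm2) cat_fun" and R :: "('o2, 'm2, 'x, 'p) cat_fun"
    and \<rho> :: "'o2 \<Rightarrow> 'm2" and \<theta> :: "'x \<Rightarrow> 'p"
    and \<eta> \<epsilon> :: "'x \<Rightarrow> 'p"
  assumes left_coreflective: "left_coreflective C\<^sub>1 \<Omega> \<L> X i Q \<eta>\<^sub>i \<epsilon>\<^sub>i"
    and right_reflective: "right_reflective C\<^sub>2 \<Sigma> \<R> X j R \<rho> \<theta>"
    and adjoint_pair: "adjunction X X (R \<circ>\<^sub>F \<Sigma> \<circ>\<^sub>F j) (Q \<circ>\<^sub>F \<Omega> \<circ>\<^sub>F i) \<eta> \<epsilon>"
    and right_to_left: "\<lbrakk>(h, g', f') \<in> induced_right_triangles \<Sigma> \<R> X j R \<theta>;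
      (h, g, f) \<in> induced_left_triangles \<Omega> \<L> X i Q \<eta>\<^sub>i;
      Dom X f' = D; Dom X f = B; Cod X f = A\<rbrakk> \<Longrightarrow>
      \<exists>s \<in> Hom X D B. s \<cdot>\<^bsub>X\<^esub> g' = g \<and> f \<cdot>\<^bsub>X\<^esub> s = \<epsilon> A \<cdot>\<^bsub>X\<^esub> f'"
    and left_to_right: "\<lbrakk>(l, m, n) \<in> induced_right_triangles \<Sigma> \<R> X j R \<theta>;
      (l', m', n) \<in> induced_left_triangles \<Omega> \<L> X i Q \<eta>\<^sub>i;
      Dom X l = A; Cod X l = Y; Cod X l' = U\<rbrakk> \<Longrightarrow>
      \<exists>t \<in> Hom X Y U. t \<cdot>\<^bsub>X\<^esub> l = l' \<cdot>\<^bsub>X\<^esub> \<eta> A \<and> m' \<cdot>\<^bsub>X\<^esub> t = m"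

text \<open>
  The parameters \<open>\<eta>\<close>, \<open>\<epsilon>\<close> are the unit and counit of the adjoint pair \<open>(\<Sigma>, \<Omega>)\<close>.
\<close>

locale pretriangulated =
  fixes C :: "('o, 'm) cat" (structure)
    and \<Sigma> \<Omega> :: "('o, 'm, 'o, 'm) cat_fun" and \<L> \<R> :: "'m tri set"
    and \<eta> \<epsilon> :: "'o \<Rightarrow> 'm"
  assumes adjoint_pair: "adjunction C C \<Sigma> \<Omega> \<eta> \<epsilon>"
    and left_triangulated: "left_triangulated C \<Omega> \<L>"
    and right_triangulated: "right_triangulated C \<Sigma> \<R>"
    and right_to_left: "\<lbrakk>(f, g, h) \<in> \<R>; (f', g', h') \<in> \<L>;
      \<alpha> \<in> Hom C (Dom C f) (FOb \<Omega> (Cod C h')); \<beta> \<in> Hom C (Cod C f) (Cod C f');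
      \<beta> \<cdot> f = f' \<cdot> \<alpha>\<rbrakk> \<Longrightarrow>
      \<exists>\<delta> \<in> Hom C (Cod C g) (Cod C g').
        \<delta> \<cdot> g = g' \<cdot> \<beta> \<and> h' \<cdot> \<delta> = \<epsilon> (Cod C h') \<cdot> FArr \<Sigma> \<alpha> \<cdot> h"
    and left_to_right: "\<lbrakk>(f, g, h) \<in> \<R>; (f', g', h') \<in> \<L>;
      \<alpha> \<in> Hom C (FOb \<Sigma> (Dom C f)) (Cod C h'); \<beta> \<in> Hom C (Cod C g) (Cod C g');
      h' \<cdot> \<beta> = \<alpha> \<cdot> h\<rbrakk> \<Longrightarrow>
      \<exists>\<delta> \<in> Hom C (Cod C f) (Cod C f').
        \<delta> \<cdot> f = f' \<cdot> FArr \<Omega> \<alpha> \<cdot> \<eta> (Dom C f) \<and> g' \<cdot> \<delta> = \<beta> \<cdot> g"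

end

theory Submission
  imports Defs
begin

text \<open>
  The left and right triangulated axioms are mirror images, so only the left half is proved:
  applied to the opposite categories, \<open>induced_left_triangulated\<close> also yields
  \<open>induced_right_triangulated\<close>.

  For the left half, write \<open>U = Q \<Omega> i\<close>. Since \<open>i\<close> is fully faithful, the unit \<open>\<eta>\<close> is invertible,
  with \<open>i(\<eta>\<^sup>-\<^sup>1) = \<epsilon>\<close> on the image of \<open>i\<close> and \<open>\<eta>\<^sup>-\<^sup>1 = Q(\<epsilon>)\<close> on the image of \<open>Q\<close>; both functors are additive. The
  existence of triangles on a given arrow, the identity triangle and the completion of morphisms are
  obtained by applying \<open>Q\<close> to their counterparts in \<open>C\<close>. Rotation and the octahedral axiom
  involve triangles of \<open>C\<close> whose last arrow is not in the image of \<open>i\<close>, and the key is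
  \<open>Q_image_triangle\<close>: for every left triangle \<open>(h, g, f)\<close> of \<open>C\<close> with \<open>f : B \<rightarrow> A\<close>, the triple
  \<open>(Q h \<cdot> Q \<Omega> \<epsilon>\<^sub>A, Q g, Q f)\<close> is an induced triangle. Indeed it is isomorphic, through the
  arrow \<open>Q t\<close> that coreflectivity makes invertible, to the triangle induced by one on \<open>i Q f\<close>.

  The two compatibility conditions of a pretriangulated structure are the two conditions of a prile
  with arbitrary arrows \<open>\<alpha>\<close>, \<open>\<beta>\<close> in place of identities. They follow by factoring through an
  auxiliary triangle (\<open>right_to_left_fill\<close>, \<open>left_to_right_fill\<close>).
\<close>


section \<open>Categories and additive categories\<close>

lemma Hom_iff: "f \<in> Hom C A B \<longleftrightarrow> f \<in> Arr C \<and> Dom C f = A \<and> Cod C f = B"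
  by (simp add: Hom_def)

lemma comp_fun_simps [simp]:
  "FOb (G \<circ>\<^sub>F F) A = FOb G (FOb F A)" "FArr (G \<circ>\<^sub>F F) f = FArr G (FArr F f)"
  by (simp_all add: comp_fun_def)

lemma id_fun_simps [simp]: "FOb id_fun A = A" "FArr id_fun f = f"
  by (simp_all add: id_fun_def)

context category
begin

lemma Comp_Arr [simp]:
  "\<lbrakk>f \<in> Arr C; g \<in> Arr C; Cod C f = Dom C g\<rbrakk> \<Longrightarrow> g \<cdot> f \<in> Arr C"
  "\<lbrakk>f \<in> Arr C; g \<in> Arr C; Cod C f = Dom C g\<rbrakk> \<Longrightarrow> Dom C (g \<cdot> f) = Dom C f"
  "\<lbrakk>f \<in> Arr C; g \<in> Arr C; Cod C f = Dom C g\<rbrakk> \<Longrightarrow> Cod C (g \<cdot> f) = Cod C g"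
  using Comp_in_Hom[of f "Dom C f" "Cod C f" g "Cod C g"] by (simp_all add: Hom_iff)

lemma Ide_Arr [simp]:
  "A \<in> Ob C \<Longrightarrow> Ide C A \<in> Arr C"
  "A \<in> Ob C \<Longrightarrow> Dom C (Ide C A) = A"
  "A \<in> Ob C \<Longrightarrow> Cod C (Ide C A) = A"
  using Ide_in_Hom[of A] by (simp_all add: Hom_iff)

lemma Dom_Cod_Ob [simp]: "f \<in> Arr C \<Longrightarrow> Dom C f \<in> Ob C" "f \<in> Arr C \<Longrightarrow> Cod C f \<in> Ob C"
  by (rule Dom_in_Ob Cod_in_Ob, assumption)+

lemma Comp_Ide [simp]:
  "\<lbrakk>f \<in> Arr C; Cod C f = B\<rbrakk> \<Longrightarrow> Ide C B \<cdot> f = f"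
  "\<lbrakk>f \<in> Arr C; Dom C f = A\<rbrakk> \<Longrightarrow> f \<cdot> Ide C A = f"
  using Comp_Ide_left[of f "Dom C f" "Cod C f"] Comp_Ide_right[of f "Dom C f" "Cod C f"]
  by (auto simp: Hom_iff)

lemma Comp_Arr_assoc [simp]:
  "\<lbrakk>f \<in> Arr C; g \<in> Arr C; h \<in> Arr C; Cod C f = Dom C g; Cod C g = Dom C h\<rbrakk> \<Longrightarrow>
    h \<cdot> g \<cdot> f = h \<cdot> (g \<cdot> f)"
  by (rule Comp_assoc[of f "Dom C f" "Cod C f" g "Cod C g" h "Cod C h"]) (simp_all add: Hom_iff)

lemma is_isoI:
  assumes "f \<in> Hom C A B" "g \<in> Hom C B A" "g \<cdot> f = Ide C A" "f \<cdot> g = Ide C B"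
  shows "is_iso C f"
  using assms unfolding is_iso_def by (auto simp: Hom_iff)

lemma is_isoE:
  assumes "is_iso C f"
  obtains g where "f \<in> Arr C" "g \<in> Arr C" "Dom C g = Cod C f" "Cod C g = Dom C f"
    "g \<cdot> f = Ide C (Dom C f)" "f \<cdot> g = Ide C (Cod C f)"
  using assms unfolding is_iso_def by (auto simp: Hom_iff)

lemma is_iso_Ide: "A \<in> Ob C \<Longrightarrow> is_iso C (Ide C A)"
  by (rule is_isoI[of _ A A "Ide C A"]) (simp_all add: Hom_iff)

lemma is_iso_Comp:
  assumes "is_iso C f" "is_iso C g" "Cod C f = Dom C g"
  shows "is_iso C (g \<cdot> f)"
proof -
  obtain f' where f: "f \<in> Arr C" "f' \<in> Arr C" "Dom C f' = Cod C f" "Cod C f' = Dom C f"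
    "f' \<cdot> f = Ide C (Dom C f)" "f \<cdot> f' = Ide C (Cod C f)" using assms(1) by (rule is_isoE)
  obtain g' where g: "g \<in> Arr C" "g' \<in> Arr C" "Dom C g' = Cod C g" "Cod C g' = Dom C g"
    "g' \<cdot> g = Ide C (Dom C g)" "g \<cdot> g' = Ide C (Cod C g)" using assms(2) by (rule is_isoE)
  have "f' \<cdot> g' \<cdot> (g \<cdot> f) = f' \<cdot> (g' \<cdot> g \<cdot> f)" using f g(1-4) assms(3) by simp
  also have "\<dots> = Ide C (Dom C f)" unfolding g(5) using f g(1-4) assms(3) by simp
  finally have 1: "f' \<cdot> g' \<cdot> (g \<cdot> f) = Ide C (Dom C f)" .
  have "g \<cdot> f \<cdot> (f' \<cdot> g') = g \<cdot> (f \<cdot> f' \<cdot> g')" using f(1-4) g assms(3) by simp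
  also have "\<dots> = Ide C (Cod C g)" unfolding f(6) using f(1-4) g assms(3) by simp
  finally have 2: "g \<cdot> f \<cdot> (f' \<cdot> g') = Ide C (Cod C g)" .
  show ?thesis
    by (rule is_isoI[OF _ _ 1 2]) (use f(1-4) g(1-4) assms(3) in \<open>simp_all add: Hom_iff\<close>)
qed

lemma arr_inv_props:
  assumes "is_iso C f"
  shows "arr_inv C f \<in> Arr C" "Dom C (arr_inv C f) = Cod C f" "Cod C (arr_inv C f) = Dom C f"
    "arr_inv C f \<cdot> f = Ide C (Dom C f)" "f \<cdot> arr_inv C f = Ide C (Cod C f)"
proof -
  obtain g where f: "f \<in> Arr C" "g \<in> Arr C" "Dom C g = Cod C f" "Cod C g = Dom C f"
    "g \<cdot> f = Ide C (Dom C f)" "f \<cdot> g = Ide C (Cod C f)" using assms by (rule is_isoE)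
  let ?P = "\<lambda>g. g \<in> Hom C (Cod C f) (Dom C f) \<and>
    g \<cdot> f = Ide C (Dom C f) \<and> f \<cdot> g = Ide C (Cod C f)"
  have "?P (THE g. ?P g)"
  proof (rule theI[of ?P g])
    show "?P g" using f by (simp add: Hom_iff)
  next
    fix g' assume g': "?P g'"
    then have "g' = g' \<cdot> (f \<cdot> g)" using f by (simp add: Hom_iff)
    also have "\<dots> = g' \<cdot> f \<cdot> g"
      using f(1-4) g' by (subst Comp_Arr_assoc) (simp_all add: Hom_iff)
    also have "\<dots> = g" using f(1-4) g' by simp
    finally show "g' = g" .
  qed
  then show "arr_inv C f \<in> Arr C" "Dom C (arr_inv C f) = Cod C f" "Cod C (arr_inv C f) = Dom C f"
    "arr_inv C f \<cdot> f = Ide C (Dom C f)" "f \<cdot> arr_inv C f = Ide C (Cod C f)"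
    unfolding arr_inv_def by (auto simp: Hom_iff)
qed

lemma is_iso_arr_inv:
  assumes "is_iso C f" shows "is_iso C (arr_inv C f)"
  by (rule is_isoI[of _ "Cod C f" "Dom C f" f])
    (use arr_inv_props[OF assms] assms in \<open>auto simp: Hom_iff is_iso_def\<close>)

end

context cat_functor
begin

lemma FArr_Arr [simp]:
  "f \<in> Arr C \<Longrightarrow> FArr F f \<in> Arr D"
  "f \<in> Arr C \<Longrightarrow> Dom D (FArr F f) = FOb F (Dom C f)"
  "f \<in> Arr C \<Longrightarrow> Cod D (FArr F f) = FOb F (Cod C f)"
  using FArr_in_Hom[of f "Dom C f" "Cod C f"] by (simp_all add: Hom_iff)

lemma FArr_Comp_Arr [simp]:
  "\<lbrakk>f \<in> Arr C; g \<in> Arr C; Cod C f = Dom C g\<rbrakk> \<Longrightarrow>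
    FArr F (g \<cdot>\<^bsub>C\<^esub> f) = FArr F g \<cdot>\<^bsub>D\<^esub> FArr F f"
  by (rule FArr_Comp[of f "Dom C f" "Cod C f" g "Cod C g"]) (simp_all add: Hom_iff)

declare FArr_Ide [simp] FOb_in_Ob [simp]

lemma FArr_square:
  assumes "a \<cdot>\<^bsub>C\<^esub> b = c \<cdot>\<^bsub>C\<^esub> d" "a \<in> Arr C" "b \<in> Arr C" "c \<in> Arr C" "d \<in> Arr C"
    "Cod C b = Dom C a" "Cod C d = Dom C c"
  shows "FArr F a \<cdot>\<^bsub>D\<^esub> FArr F b = FArr F c \<cdot>\<^bsub>D\<^esub> FArr F d"
  using assms FArr_Comp_Arr[of b a] FArr_Comp_Arr[of d c] by simp

lemma FArr_is_iso:
  assumes "is_iso C f" shows "is_iso D (FArr F f)"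
proof -
  obtain g where f: "f \<in> Arr C" "g \<in> Arr C" "Dom C g = Cod C f" "Cod C g = Dom C f"
    "g \<cdot>\<^bsub>C\<^esub> f = Ide C (Dom C f)" "f \<cdot>\<^bsub>C\<^esub> g = Ide C (Cod C f)"
    using assms by (rule src.is_isoE)
  show ?thesis
    by (rule tgt.is_isoI[of _ "FOb F (Dom C f)" "FOb F (Cod C f)" "FArr F g"])
      (use f FArr_Comp_Arr[of f g] FArr_Comp_Arr[of g f] in \<open>simp_all add: Hom_iff\<close>)
qed

end

lemma cat_functor_comp_fun:
  assumes "cat_functor C D F" "cat_functor D E G"
  shows "cat_functor C E (G \<circ>\<^sub>F F)"
proof -
  interpret F: cat_functor C D F by fact
  interpret G: cat_functor D E G by fact
  show ?thesis
    by unfold_locales (auto simp: Hom_iff)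
qed

lemma additive_functor_comp_fun:
  assumes "additive_functor C D F" "additive_functor D E G"
  shows "additive_functor C E (G \<circ>\<^sub>F F)"
proof -
  interpret F: additive_functor C D F by fact
  interpret G: additive_functor D E G by fact
  interpret cat_functor C E "G \<circ>\<^sub>F F"
    by (rule cat_functor_comp_fun) unfold_locales
  show ?thesis
    by unfold_locales (simp add: F.FArr_Add G.FArr_Add[OF F.FArr_in_Hom F.FArr_in_Hom])
qed

context additive_category
begin

lemma Add_in_Hom: "\<lbrakk>f \<in> Hom C A B; g \<in> Hom C A B\<rbrakk> \<Longrightarrow> f \<oplus> g \<in> Hom C A B"
  using monoid.m_closed[OF group.is_monoid[OF comm_group.axioms(2)[OF comm_group_Hom]], of A B f g]
    Dom_in_Ob[of f] Cod_in_Ob[of f]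
  by (auto simp: hom_group_def Hom_iff)

lemma Zero_in_Hom: "\<lbrakk>A \<in> Ob C; B \<in> Ob C\<rbrakk> \<Longrightarrow> Zero C A B \<in> Hom C A B"
  using monoid.one_closed[OF group.is_monoid[OF comm_group.axioms(2)[OF comm_group_Hom]], of A B]
  by (simp add: hom_group_def)

lemma Zero_Arr [simp]:
  "\<lbrakk>A \<in> Ob C; B \<in> Ob C\<rbrakk> \<Longrightarrow> Zero C A B \<in> Arr C"
  "\<lbrakk>A \<in> Ob C; B \<in> Ob C\<rbrakk> \<Longrightarrow> Dom C (Zero C A B) = A"
  "\<lbrakk>A \<in> Ob C; B \<in> Ob C\<rbrakk> \<Longrightarrow> Cod C (Zero C A B) = B"
  using Zero_in_Hom[of A B] by (simp_all add: Hom_iff)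

lemma Add_Zero:
  assumes "f \<in> Hom C A B"
  shows "f \<oplus> Zero C A B = f" "Zero C A B \<oplus> f = f"
proof -
  have "A \<in> Ob C" "B \<in> Ob C" using assms Dom_in_Ob[of f] Cod_in_Ob[of f] by (auto simp: Hom_iff)
  then interpret comm_group "hom_group C A B" by (rule comm_group_Hom)
  show "f \<oplus> Zero C A B = f" "Zero C A B \<oplus> f = f"
    using r_one[of f] l_one[of f] assms by (simp_all add: hom_group_def)
qed

lemma Add_idem_Zero:
  assumes "f \<in> Hom C A B" "f \<oplus> f = f"
  shows "f = Zero C A B"
proof -
  have "A \<in> Ob C" "B \<in> Ob C" using assms Dom_in_Ob[of f] Cod_in_Ob[of f] by (auto simp: Hom_iff)
  then interpret comm_group "hom_group C A B" by (rule comm_group_Hom)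
  show ?thesis
    using l_cancel_one[of f f] assms by (simp add: hom_group_def)
qed

lemma Comp_Zero:
  assumes "g \<in> Hom C B D" "A \<in> Ob C"
  shows "g \<cdot> Zero C A B = Zero C A D" "Zero C D A \<cdot> g = Zero C B A"
proof -
  have B: "B \<in> Ob C" "D \<in> Ob C" using assms Dom_in_Ob[of g] Cod_in_Ob[of g] by (auto simp: Hom_iff)
  have z: "Zero C A B \<in> Hom C A B" "Zero C D A \<in> Hom C D A"
    using B assms(2) by (simp_all add: Zero_in_Hom)
  show "g \<cdot> Zero C A B = Zero C A D"
    by (rule Add_idem_Zero)
      (use z assms Comp_Add_right[OF z(1) z(1) assms(1)] in
        \<open>simp_all add: Comp_in_Hom[OF z(1) assms(1)] Add_Zero[OF z(1)]\<close>)
  show "Zero C D A \<cdot> g = Zero C B A"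
    by (rule Add_idem_Zero)
      (use z assms Comp_Add_left[OF assms(1) z(2) z(2)] in
        \<open>simp_all add: Comp_in_Hom[OF assms(1) z(2)] Add_Zero[OF z(2)]\<close>)
qed

lemma arr_minus_props:
  assumes "f \<in> Hom C A B"
  shows "arr_minus C f \<in> Hom C A B" "arr_minus C f \<oplus> f = Zero C A B"
    "\<And>g. \<lbrakk>g \<in> Hom C A B; g \<oplus> f = Zero C A B\<rbrakk> \<Longrightarrow> g = arr_minus C f"
proof -
  have f: "Dom C f = A" "Cod C f = B" using assms by (simp_all add: Hom_iff)
  have "A \<in> Ob C" "B \<in> Ob C" using assms Dom_in_Ob[of f] Cod_in_Ob[of f] by (auto simp: Hom_iff)
  then interpret comm_group "hom_group C A B" by (rule comm_group_Hom)
  show "arr_minus C f \<in> Hom C A B" "arr_minus C f \<oplus> f = Zero C A B"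
    using inv_closed[of f] l_inv[of f] assms f by (simp_all add: hom_group_def arr_minus_def)
  show "g = arr_minus C f" if "g \<in> Hom C A B" "g \<oplus> f = Zero C A B" for g
    using inv_equality[of g f] that assms f by (simp add: hom_group_def arr_minus_def)
qed

lemma arr_minus_Arr [simp]:
  "f \<in> Arr C \<Longrightarrow> arr_minus C f \<in> Arr C"
  "f \<in> Arr C \<Longrightarrow> Dom C (arr_minus C f) = Dom C f"
  "f \<in> Arr C \<Longrightarrow> Cod C (arr_minus C f) = Cod C f"
  using arr_minus_props(1)[of f "Dom C f" "Cod C f"] by (simp_all add: Hom_iff)

lemma Comp_arr_minus:
  assumes "f \<in> Hom C A B" "g \<in> Hom C B D"
  shows "g \<cdot> arr_minus C f = arr_minus C (g \<cdot> f)" "arr_minus C g \<cdot> f = arr_minus C (g \<cdot> f)"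
proof -
  have ob: "A \<in> Ob C" "D \<in> Ob C" using assms by (auto simp: Hom_iff)
  note gf = Comp_in_Hom[OF assms]
  note f = arr_minus_props[OF assms(1)] and g = arr_minus_props[OF assms(2)]
  show "g \<cdot> arr_minus C f = arr_minus C (g \<cdot> f)"
    by (rule arr_minus_props(3)[OF gf])
      (simp_all add: Comp_in_Hom[OF f(1) assms(2)] Comp_Add_right[OF f(1) assms, symmetric] f(2)
        Comp_Zero(1)[OF assms(2) ob(1)])
  show "arr_minus C g \<cdot> f = arr_minus C (g \<cdot> f)"
    by (rule arr_minus_props(3)[OF gf])
      (simp_all add: Comp_in_Hom[OF assms(1) g(1)] Comp_Add_left[OF assms(1) g(1) assms(2), symmetric]
        g(2) Comp_Zero(2)[OF assms(1) ob(2)])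
qed

lemma zero_object_iff: "zero_object C Z \<longleftrightarrow> Z \<in> Ob C \<and> Ide C Z = Zero C Z Z"
proof
  assume "zero_object C Z"
  then show "Z \<in> Ob C \<and> Ide C Z = Zero C Z Z"
    unfolding zero_object_def using Ide_in_Hom[of Z] Zero_in_Hom[of Z Z] by blast
next
  assume Z: "Z \<in> Ob C \<and> Ide C Z = Zero C Z Z"
  have "\<exists>!f. f \<in> Hom C A Z" "\<exists>!f. f \<in> Hom C Z A" if "A \<in> Ob C" for A
  proof -
    have "f = Zero C A Z" if "f \<in> Hom C A Z" for f
      using Comp_Ide_left[OF that] Comp_Zero(2)[OF that, of Z] Z by simp
    then show "\<exists>!f. f \<in> Hom C A Z" using Zero_in_Hom[of A Z] Z \<open>A \<in> Ob C\<close> by blast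
    have "f = Zero C Z A" if "f \<in> Hom C Z A" for f
      using Comp_Ide_right[OF that] Comp_Zero(1)[OF that, of Z] Z by simp
    then show "\<exists>!f. f \<in> Hom C Z A" using Zero_in_Hom[of Z A] Z \<open>A \<in> Ob C\<close> by blast
  qed
  then show "zero_object C Z" using Z by (simp add: zero_object_def)
qed

end

lemma additive_functor_Zero:
  assumes "additive_category C" "additive_category D" "additive_functor C D F" "A \<in> Ob C" "B \<in> Ob C"
  shows "FArr F (Zero C A B) = Zero D (FOb F A) (FOb F B)"
proof -
  interpret C: additive_category C by fact
  interpret D: additive_category D by fact
  interpret additive_functor C D F by fact
  have z: "Zero C A B \<in> Hom C A B" using assms C.Zero_in_Hom by blast
  show ?thesis
    by (rule D.Add_idem_Zero[OF FArr_in_Hom[OF z]])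
      (simp add: FArr_Add[OF z z, symmetric] C.Add_Zero[OF z])
qed

lemma additive_functor_arr_minus:
  assumes "additive_category C" "additive_category D" "additive_functor C D F" "f \<in> Arr C"
  shows "FArr F (arr_minus C f) = arr_minus D (FArr F f)"
proof -
  interpret C: additive_category C by fact
  interpret D: additive_category D by fact
  interpret additive_functor C D F by fact
  have f: "f \<in> Hom C (Dom C f) (Cod C f)" using assms(4) by (simp add: Hom_iff)
  note m = C.arr_minus_props[OF f]
  show ?thesis
    by (rule D.arr_minus_props(3)[OF FArr_in_Hom[OF f] FArr_in_Hom[OF m(1)]])
      (use assms(4) in \<open>simp add: FArr_Add[OF m(1) f, symmetric] m(2)
        additive_functor_Zero[OF assms(1-3)]\<close>)
qed


section \<open>Adjunctions\<close>

context adjunction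
begin

lemma unit_Arr [simp]:
  "A \<in> Ob C \<Longrightarrow> \<eta> A \<in> Arr C" "A \<in> Ob C \<Longrightarrow> Dom C (\<eta> A) = A"
  "A \<in> Ob C \<Longrightarrow> Cod C (\<eta> A) = FOb G (FOb F A)"
  using unit.component_in_Hom[of A] by (simp_all add: Hom_iff)

lemma counit_Arr [simp]:
  "B \<in> Ob D \<Longrightarrow> \<epsilon> B \<in> Arr D" "B \<in> Ob D \<Longrightarrow> Dom D (\<epsilon> B) = FOb F (FOb G B)"
  "B \<in> Ob D \<Longrightarrow> Cod D (\<epsilon> B) = B"
  using counit.component_in_Hom[of B] by (simp_all add: Hom_iff)

lemma unit_naturality:
  "f \<in> Arr C \<Longrightarrow> \<eta> (Cod C f) \<cdot>\<^bsub>C\<^esub> f = FArr G (FArr F f) \<cdot>\<^bsub>C\<^esub> \<eta> (Dom C f)"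
  using unit.naturality[of f "Dom C f" "Cod C f"] by (simp add: Hom_iff)

lemma counit_naturality:
  "f \<in> Arr D \<Longrightarrow> \<epsilon> (Cod D f) \<cdot>\<^bsub>D\<^esub> FArr F (FArr G f) = f \<cdot>\<^bsub>D\<^esub> \<epsilon> (Dom D f)"
  using counit.naturality[of f "Dom D f" "Cod D f"] by (simp add: Hom_iff)

text \<open>An arrow \<open>u : A \<rightarrow> G B\<close> is recovered from its transpose \<open>\<epsilon> \<cdot> F u : F A \<rightarrow> B\<close>.\<close>

lemma transpose_inverse:
  assumes "u \<in> Arr C" "Cod C u = FOb G B" "B \<in> Ob D"
  shows "FArr G (\<epsilon> B \<cdot>\<^bsub>D\<^esub> FArr F u) \<cdot>\<^bsub>C\<^esub> \<eta> (Dom C u) = u"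
proof -
  have "FArr G (\<epsilon> B \<cdot>\<^bsub>D\<^esub> FArr F u) \<cdot>\<^bsub>C\<^esub> \<eta> (Dom C u)
      = FArr G (\<epsilon> B) \<cdot>\<^bsub>C\<^esub> (FArr G (FArr F u) \<cdot>\<^bsub>C\<^esub> \<eta> (Dom C u))"
    using assms by simp
  also have "\<dots> = FArr G (\<epsilon> B) \<cdot>\<^bsub>C\<^esub> (\<eta> (FOb G B) \<cdot>\<^bsub>C\<^esub> u)"
    using unit_naturality[OF assms(1)] assms by simp
  also have "\<dots> = FArr G (\<epsilon> B) \<cdot>\<^bsub>C\<^esub> \<eta> (FOb G B) \<cdot>\<^bsub>C\<^esub> u" using assms by simp
  also have "\<dots> = u" using triangle_G[OF assms(3)] assms by simp
  finally show ?thesis .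
qed

lemma transpose_inj:
  assumes "u \<in> Hom C A (FOb G B)" "v \<in> Hom C A (FOb G B)" "B \<in> Ob D"
    "\<epsilon> B \<cdot>\<^bsub>D\<^esub> FArr F u = \<epsilon> B \<cdot>\<^bsub>D\<^esub> FArr F v"
  shows "u = v"
  using transpose_inverse[of u B] transpose_inverse[of v B] assms unfolding Hom_iff by metis

lemma unit_is_iso:
  assumes "fully_faithful C D F" "A \<in> Ob C"
  shows "is_iso C (\<eta> A)"
proof -
  let ?GF = "FOb G (FOb F A)"
  have bij: "bij_betw (FArr F) (Hom C B E) (Hom D (FOb F B) (FOb F E))"
    if "B \<in> Ob C" "E \<in> Ob C" for B E using assms that by (simp add: fully_faithful_def)
  have "\<epsilon> (FOb F A) \<in> FArr F ` Hom C ?GF A"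
    using bij[of ?GF A] assms by (simp add: bij_betw_def Hom_iff)
  \<comment> \<open>fullness: the inverse of the unit is the preimage of the counit\<close>
  then obtain k where k: "k \<in> Hom C ?GF A" "FArr F k = \<epsilon> (FOb F A)" by auto
  have "FArr F (k \<cdot>\<^bsub>C\<^esub> \<eta> A) = FArr F (Ide C A)"
    using k assms triangle_F[OF assms(2)] by (simp add: Hom_iff)
  moreover have "inj_on (FArr F) (Hom C A A)" using bij assms by (simp add: bij_betw_def)
  moreover have "k \<cdot>\<^bsub>C\<^esub> \<eta> A \<in> Hom C A A" "Ide C A \<in> Hom C A A"
    using k assms by (simp_all add: Hom_iff)
  ultimately have 1: "k \<cdot>\<^bsub>C\<^esub> \<eta> A = Ide C A" by (meson inj_onD)
  have 2: "\<eta> A \<cdot>\<^bsub>C\<^esub> k = Ide C ?GF"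
    using unit_naturality[of k] k triangle_G[of "FOb F A"] assms by (simp add: Hom_iff)
  show ?thesis by (rule F.src.is_isoI[OF _ k(1) 1 2]) (use assms in \<open>simp add: Hom_iff\<close>)
qed

text \<open>
  A right adjoint preserves zero objects and the projections of a biproduct \<open>B \<oplus> B\<close>, and the sum
  of two arrows to \<open>B\<close> is the pairing into \<open>B \<oplus> B\<close> followed by the sum of the projections.
\<close>

lemma right_adjoint_additive:
  assumes "additive_category C" "additive_category D"
  shows "additive_functor D C G"
proof -
  interpret C: additive_category C by fact
  interpret D: additive_category D by fact
  have G0: "FArr G (Zero D A B) = Zero C (FOb G A) (FOb G B)" if ob: "A \<in> Ob D" "B \<in> Ob D" for A B
  proof -
    obtain Z where Z: "zero_object D Z" using D.ex_zero_object by blast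
    then have ZOb: "Z \<in> Ob D" by (simp add: zero_object_def)
    \<comment> \<open>\<open>G Z\<close> is terminal, as arrows to it are transposes of arrows to \<open>Z\<close>.\<close>
    have "FArr G (Zero D A Z) = Zero C (FOb G A) (FOb G Z)"
    proof (rule transpose_inj[OF _ _ ZOb])
      let ?u = "\<epsilon> Z \<cdot>\<^bsub>D\<^esub> FArr F (FArr G (Zero D A Z))"
      let ?v = "\<epsilon> Z \<cdot>\<^bsub>D\<^esub> FArr F (Zero C (FOb G A) (FOb G Z))"
      have "?u \<in> Hom D (FOb F (FOb G A)) Z" "?v \<in> Hom D (FOb F (FOb G A)) Z"
        using ob ZOb by (simp_all add: Hom_iff)
      then show "?u = ?v" using Z ob unfolding zero_object_def by (metis G.FOb_in_Ob F.FOb_in_Ob)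
    qed (use ob ZOb in \<open>simp_all add: Hom_iff\<close>)
    moreover have "Zero D Z B \<cdot>\<^bsub>D\<^esub> Zero D A Z = Zero D A B"
      by (rule D.Comp_Zero(1)) (use ob ZOb in \<open>simp_all add: Hom_iff\<close>)
    moreover have "FArr G (Zero D Z B \<cdot>\<^bsub>D\<^esub> Zero D A Z)
        = FArr G (Zero D Z B) \<cdot>\<^bsub>C\<^esub> FArr G (Zero D A Z)" using ob ZOb by simp
    moreover have "FArr G (Zero D Z B) \<cdot>\<^bsub>C\<^esub> Zero C (FOb G A) (FOb G Z)
        = Zero C (FOb G A) (FOb G B)"
      by (rule C.Comp_Zero(1)) (use ob ZOb in \<open>simp_all add: Hom_iff\<close>)
    ultimately show ?thesis by simp
  qed
  show ?thesis
  proof unfold_locales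
    fix f g A B assume fg: "f \<in> Hom D A B" "g \<in> Hom D A B"
    then have ob: "A \<in> Ob D" "B \<in> Ob D" by (auto simp: Hom_iff)
    obtain P i1 i2 p1 p2 where P: "P \<in> Ob D"
      and h: "i1 \<in> Hom D B P" "i2 \<in> Hom D B P" "p1 \<in> Hom D P B" "p2 \<in> Hom D P B"
      and e: "p1 \<cdot>\<^bsub>D\<^esub> i1 = Ide D B" "p2 \<cdot>\<^bsub>D\<^esub> i2 = Ide D B"
        "p1 \<cdot>\<^bsub>D\<^esub> i2 = Zero D B B" "p2 \<cdot>\<^bsub>D\<^esub> i1 = Zero D B B"
        "i1 \<cdot>\<^bsub>D\<^esub> p1 \<oplus>\<^bsub>D\<^esub> i2 \<cdot>\<^bsub>D\<^esub> p2 = Ide D P"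
      using D.ex_biproduct[OF ob(2) ob(2)] by blast
    note a = h[unfolded Hom_iff] note fga = fg[unfolded Hom_iff]
    note Gh = h[THEN G.FArr_in_Hom]
    note Ga = Gh[unfolded Hom_iff]
    have GP: "FOb G P \<in> Ob C" "FOb G B \<in> Ob C" using P ob by simp_all
    \<comment> \<open>The images of the projections are jointly monic.\<close>
    have joint: "u = v" if uv: "u \<in> Hom C W (FOb G P)" "v \<in> Hom C W (FOb G P)"
      "FArr G p1 \<cdot>\<^bsub>C\<^esub> u = FArr G p1 \<cdot>\<^bsub>C\<^esub> v" "FArr G p2 \<cdot>\<^bsub>C\<^esub> u = FArr G p2 \<cdot>\<^bsub>C\<^esub> v" for u v W
    proof (rule transpose_inj[OF uv(1,2) P])
      define t where "t w = \<epsilon> P \<cdot>\<^bsub>D\<^esub> FArr F w" for w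
      note uva = uv(1,2)[unfolded Hom_iff]
      have tH: "t w \<in> Hom D (FOb F W) P" if "w \<in> Hom C W (FOb G P)" for w
        using that P by (auto simp: Hom_iff t_def)
      have pt: "p \<cdot>\<^bsub>D\<^esub> t w = \<epsilon> B \<cdot>\<^bsub>D\<^esub> FArr F (FArr G p \<cdot>\<^bsub>C\<^esub> w)"
        if w: "w \<in> Hom C W (FOb G P)" and p: "p \<in> Hom D P B" for p w
      proof -
        have "p \<cdot>\<^bsub>D\<^esub> t w = p \<cdot>\<^bsub>D\<^esub> \<epsilon> P \<cdot>\<^bsub>D\<^esub> FArr F w" using w p P by (simp add: t_def Hom_iff)
        also have "p \<cdot>\<^bsub>D\<^esub> \<epsilon> P = \<epsilon> B \<cdot>\<^bsub>D\<^esub> FArr F (FArr G p)"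
          using counit_naturality[of p] p by (simp add: Hom_iff)
        finally show ?thesis using w p ob P by (simp add: Hom_iff)
      qed
      have split: "t w = i1 \<cdot>\<^bsub>D\<^esub> (p1 \<cdot>\<^bsub>D\<^esub> t w) \<oplus>\<^bsub>D\<^esub> i2 \<cdot>\<^bsub>D\<^esub> (p2 \<cdot>\<^bsub>D\<^esub> t w)"
        if w: "w \<in> Hom C W (FOb G P)" for w
      proof -
        have "t w = (i1 \<cdot>\<^bsub>D\<^esub> p1 \<oplus>\<^bsub>D\<^esub> i2 \<cdot>\<^bsub>D\<^esub> p2) \<cdot>\<^bsub>D\<^esub> t w"
          using e(5) F.tgt.Comp_Ide_left[OF tH[OF w]] by simp
        also have "\<dots> = i1 \<cdot>\<^bsub>D\<^esub> p1 \<cdot>\<^bsub>D\<^esub> t w \<oplus>\<^bsub>D\<^esub> i2 \<cdot>\<^bsub>D\<^esub> p2 \<cdot>\<^bsub>D\<^esub> t w"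
          by (rule D.Comp_Add_left[OF tH[OF w]]) (use a in \<open>simp_all add: Hom_iff\<close>)
        finally show ?thesis using a tH[OF w] by (simp add: Hom_iff)
      qed
      show "\<epsilon> P \<cdot>\<^bsub>D\<^esub> FArr F u = \<epsilon> P \<cdot>\<^bsub>D\<^esub> FArr F v"
        using split[OF uv(1)] split[OF uv(2)] uv h by (simp add: pt t_def[symmetric])
    qed
    have i0: "FArr G i1 \<cdot>\<^bsub>C\<^esub> FArr G p1 \<in> Hom C (FOb G P) (FOb G P)"
      "FArr G i2 \<cdot>\<^bsub>C\<^esub> FArr G p2 \<in> Hom C (FOb G P) (FOb G P)"
      using a by (simp_all add: Hom_iff)
    have G2: "FArr G p1 \<cdot>\<^bsub>C\<^esub> FArr G i1 = Ide C (FOb G B)" "FArr G p2 \<cdot>\<^bsub>C\<^esub> FArr G i2 = Ide C (FOb G B)"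
        "FArr G p1 \<cdot>\<^bsub>C\<^esub> FArr G i2 = Zero C (FOb G B) (FOb G B)"
        "FArr G p2 \<cdot>\<^bsub>C\<^esub> FArr G i1 = Zero C (FOb G B) (FOb G B)"
      using e(1-4)[THEN arg_cong, of "FArr G"] a ob by (simp_all add: G0)
    have G3: "FArr G p1 \<cdot>\<^bsub>C\<^esub> (FArr G i1 \<cdot>\<^bsub>C\<^esub> FArr G p1) = FArr G p1"
      "FArr G p2 \<cdot>\<^bsub>C\<^esub> (FArr G i2 \<cdot>\<^bsub>C\<^esub> FArr G p2) = FArr G p2"
      "FArr G p1 \<cdot>\<^bsub>C\<^esub> (FArr G i2 \<cdot>\<^bsub>C\<^esub> FArr G p2) = Zero C (FOb G P) (FOb G B)"
      "FArr G p2 \<cdot>\<^bsub>C\<^esub> (FArr G i1 \<cdot>\<^bsub>C\<^esub> FArr G p1) = Zero C (FOb G P) (FOb G B)"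
      using G2 F.src.Comp_assoc[OF Gh(3) Gh(1) Gh(3)] F.src.Comp_assoc[OF Gh(4) Gh(2) Gh(4)]
        F.src.Comp_assoc[OF Gh(4) Gh(2) Gh(3)] F.src.Comp_assoc[OF Gh(3) Gh(1) Gh(4)]
        C.Comp_Zero(2)[OF Gh(3) GP(2)] C.Comp_Zero(2)[OF Gh(4) GP(2)]
        F.src.Comp_Ide_left[OF Gh(3)] F.src.Comp_Ide_left[OF Gh(4)] by simp_all
    have GP_split: "FArr G i1 \<cdot>\<^bsub>C\<^esub> FArr G p1 \<oplus>\<^bsub>C\<^esub> FArr G i2 \<cdot>\<^bsub>C\<^esub> FArr G p2 = Ide C (FOb G P)"
      by (rule joint[of _ "FOb G P"])
        (simp_all add: C.Add_in_Hom[OF i0] F.src.Ide_in_Hom[OF GP(1)] C.Comp_Add_right[OF i0 Gh(3)]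
          C.Comp_Add_right[OF i0 Gh(4)] G3 F.src.Comp_Ide_right[OF Gh(3)] F.src.Comp_Ide_right[OF Gh(4)]
          C.Add_Zero[OF Gh(3)] C.Add_Zero[OF Gh(4)])
    \<comment> \<open>the pairing \<open>u\<close> of \<open>f\<close> and \<open>g\<close>, and the sum \<open>s\<close> of the projections\<close>
    define u where "u = i1 \<cdot>\<^bsub>D\<^esub> f \<oplus>\<^bsub>D\<^esub> i2 \<cdot>\<^bsub>D\<^esub> g"
    define s where "s = p1 \<oplus>\<^bsub>D\<^esub> p2"
    have if_H: "i1 \<cdot>\<^bsub>D\<^esub> f \<in> Hom D A P" "i2 \<cdot>\<^bsub>D\<^esub> g \<in> Hom D A P"
      using a fga by (simp_all add: Hom_iff)
    have u: "u \<in> Hom D A P" unfolding u_def by (rule D.Add_in_Hom[OF if_H])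
    have s: "s \<in> Hom D P B" unfolding s_def by (rule D.Add_in_Hom[OF h(3,4)])
    have pif: "p1 \<cdot>\<^bsub>D\<^esub> (i1 \<cdot>\<^bsub>D\<^esub> f) = f" "p2 \<cdot>\<^bsub>D\<^esub> (i2 \<cdot>\<^bsub>D\<^esub> g) = g"
      "p1 \<cdot>\<^bsub>D\<^esub> (i2 \<cdot>\<^bsub>D\<^esub> g) = Zero D A B" "p2 \<cdot>\<^bsub>D\<^esub> (i1 \<cdot>\<^bsub>D\<^esub> f) = Zero D A B"
      using e F.tgt.Comp_assoc[OF fg(1) h(1) h(3)] F.tgt.Comp_assoc[OF fg(2) h(2) h(4)]
        F.tgt.Comp_assoc[OF fg(2) h(2) h(3)] F.tgt.Comp_assoc[OF fg(1) h(1) h(4)]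
        D.Comp_Zero(2)[OF fg(1) ob(2)] D.Comp_Zero(2)[OF fg(2) ob(2)]
        F.tgt.Comp_Ide_left[OF fg(1)] F.tgt.Comp_Ide_left[OF fg(2)] by simp_all
    have pu: "p1 \<cdot>\<^bsub>D\<^esub> u = f" "p2 \<cdot>\<^bsub>D\<^esub> u = g"
      unfolding u_def by (simp_all add: D.Comp_Add_right[OF if_H h(3)] D.Comp_Add_right[OF if_H h(4)]
        pif D.Add_Zero[OF fg(1)] D.Add_Zero[OF fg(2)])
    have su: "s \<cdot>\<^bsub>D\<^esub> u = f \<oplus>\<^bsub>D\<^esub> g"
      unfolding s_def using D.Comp_Add_left[OF u h(3,4)] pu by simp
    have I: "Ide D B \<in> Hom D B B" using ob by (simp add: F.tgt.Ide_in_Hom)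
    have si: "s \<cdot>\<^bsub>D\<^esub> i1 = Ide D B" "s \<cdot>\<^bsub>D\<^esub> i2 = Ide D B"
      unfolding s_def using D.Comp_Add_left[OF h(1) h(3,4)] D.Comp_Add_left[OF h(2) h(3,4)]
      by (simp_all add: e D.Add_Zero[OF I])
    note Gs = G.FArr_in_Hom[OF s] and Gu = G.FArr_in_Hom[OF u]
    have Gsu: "FArr G s \<cdot>\<^bsub>C\<^esub> (FArr G i \<cdot>\<^bsub>C\<^esub> FArr G p) \<cdot>\<^bsub>C\<^esub> FArr G u = FArr G (p \<cdot>\<^bsub>D\<^esub> u)"
      if "i \<in> Hom D B P" "p \<in> Hom D P B" "s \<cdot>\<^bsub>D\<^esub> i = Ide D B" for i p
    proof -
      have "FArr G s \<cdot>\<^bsub>C\<^esub> (FArr G i \<cdot>\<^bsub>C\<^esub> FArr G p) \<cdot>\<^bsub>C\<^esub> FArr G u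
          = FArr G (s \<cdot>\<^bsub>D\<^esub> i) \<cdot>\<^bsub>C\<^esub> FArr G (p \<cdot>\<^bsub>D\<^esub> u)"
        using that(1,2) s u by (simp add: Hom_iff)
      then show ?thesis using that s u ob by (simp add: Hom_iff)
    qed
    have "FArr G (f \<oplus>\<^bsub>D\<^esub> g) = FArr G s \<cdot>\<^bsub>C\<^esub> FArr G u"
      using s u unfolding su[symmetric] by (simp add: Hom_iff)
    also have "\<dots> = FArr G s \<cdot>\<^bsub>C\<^esub>
        (FArr G i1 \<cdot>\<^bsub>C\<^esub> FArr G p1 \<oplus>\<^bsub>C\<^esub> FArr G i2 \<cdot>\<^bsub>C\<^esub> FArr G p2) \<cdot>\<^bsub>C\<^esub> FArr G u"
      using GP_split F.src.Comp_Ide_right[OF Gs] by simp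
    also have "\<dots> = FArr G f \<oplus>\<^bsub>C\<^esub> FArr G g"
      using C.Comp_Add_right[OF i0 Gs] C.Comp_Add_left[OF Gu F.src.Comp_in_Hom[OF i0(1) Gs]
          F.src.Comp_in_Hom[OF i0(2) Gs]] Gsu[OF h(1,3) si(1)] Gsu[OF h(2,4) si(2)] pu by simp
    finally show "FArr G (f \<oplus>\<^bsub>D\<^esub> g) = FArr G f \<oplus>\<^bsub>C\<^esub> FArr G g" .
  qed
qed

text \<open>
  The left adjoint is additive as well; for a fully faithful one this follows from the additivity
  of \<open>G\<close> because \<open>G F\<close> is isomorphic to the identity.
\<close>

lemma fully_faithful_left_adjoint_additive:
  assumes "additive_category C" "additive_category D" "fully_faithful C D F"
  shows "additive_functor C D F"
proof -
  interpret C: additive_category C by fact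
  interpret D: additive_category D by fact
  interpret GA: additive_functor D C G by (rule right_adjoint_additive[OF assms(1,2)])
  show ?thesis
  proof unfold_locales
    fix f g A B assume fg: "f \<in> Hom C A B" "g \<in> Hom C A B"
    then have ob: "A \<in> Ob C" "B \<in> Ob C" by (auto simp: Hom_iff)
    note Ffg = fg[THEN F.FArr_in_Hom]
    have S: "FArr F f \<oplus>\<^bsub>D\<^esub> FArr F g \<in> Hom D (FOb F A) (FOb F B)" by (rule D.Add_in_Hom[OF Ffg])
    then have "FArr F f \<oplus>\<^bsub>D\<^esub> FArr F g \<in> FArr F ` Hom C A B"
      using assms(3) ob by (auto simp: fully_faithful_def bij_betw_def)
    then obtain k where k: "k \<in> Hom C A B" "FArr F k = FArr F f \<oplus>\<^bsub>D\<^esub> FArr F g" by force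
    note GFfg = Ffg[THEN G.FArr_in_Hom]
    have \<eta>: "\<eta> A \<in> Hom C A (FOb G (FOb F A))" "\<eta> B \<in> Hom C B (FOb G (FOb F B))"
      using ob by (simp_all add: Hom_iff)
    have nat: "FArr G (FArr F w) \<cdot>\<^bsub>C\<^esub> \<eta> A = \<eta> B \<cdot>\<^bsub>C\<^esub> w" if "w \<in> Hom C A B" for w
      using unit_naturality[of w] that by (simp add: Hom_iff)
    have "\<eta> B \<cdot>\<^bsub>C\<^esub> k = (FArr G (FArr F f) \<oplus>\<^bsub>C\<^esub> FArr G (FArr F g)) \<cdot>\<^bsub>C\<^esub> \<eta> A"
      using nat[OF k(1)] k(2) GA.FArr_Add[OF Ffg] by simp
    also have "\<dots> = \<eta> B \<cdot>\<^bsub>C\<^esub> (f \<oplus>\<^bsub>C\<^esub> g)"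
      using C.Comp_Add_left[OF \<eta>(1) GFfg] C.Comp_Add_right[OF fg \<eta>(2)] nat fg by simp
    finally have eq: "\<eta> B \<cdot>\<^bsub>C\<^esub> k = \<eta> B \<cdot>\<^bsub>C\<^esub> (f \<oplus>\<^bsub>C\<^esub> g)" .
    obtain e where e: "e \<in> Hom C (FOb G (FOb F B)) B" "e \<cdot>\<^bsub>C\<^esub> \<eta> B = Ide C B"
      using unit_is_iso[OF assms(3) ob(2)] ob(2) by (auto elim!: F.src.is_isoE simp: Hom_iff)
    have "w = e \<cdot>\<^bsub>C\<^esub> (\<eta> B \<cdot>\<^bsub>C\<^esub> w)" if "w \<in> Hom C A B" for w
      using F.src.Comp_assoc[OF that \<eta>(2) e(1)] e(2) F.src.Comp_Ide_left[OF that] by simp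
    then have "k = f \<oplus>\<^bsub>C\<^esub> g" using eq k(1) C.Add_in_Hom[OF fg] by metis
    then show "FArr F (f \<oplus>\<^bsub>C\<^esub> g) = FArr F f \<oplus>\<^bsub>D\<^esub> FArr F g" using k(2) by simp
  qed
qed

end


section \<open>Morphisms and isomorphisms of left triangles\<close>

context category
begin

text \<open>If the vertical arrows \<open>a\<close>, \<open>b\<close> of a commuting square are inverted, the square still commutes.\<close>

lemma square_inverse:
  assumes "b \<cdot> x = y \<cdot> a" "b' \<cdot> b = Ide C (Dom C b)" "a \<cdot> a' = Ide C (Cod C a)"
    and [simp]: "x \<in> Arr C" "y \<in> Arr C" "a \<in> Arr C" "b \<in> Arr C" "a' \<in> Arr C" "b' \<in> Arr C"
    "Cod C x = Dom C b" "Cod C a = Dom C y" "Dom C b' = Cod C b" "Cod C a' = Dom C a"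
  shows "b' \<cdot> y = x \<cdot> a'"
proof -
  have dom: "Dom C a = Dom C x" and cod: "Cod C y = Cod C b"
    using Comp_Arr(2,3)[of x b] Comp_Arr(2,3)[of a y] assms(1) by auto
  have "b' \<cdot> y = b' \<cdot> (y \<cdot> (a \<cdot> a'))" using assms(3) cod by simp
  also have "\<dots> = b' \<cdot> (y \<cdot> a \<cdot> a')" using cod by simp
  also have "\<dots> = b' \<cdot> (b \<cdot> x \<cdot> a')" using assms(1) by simp
  also have "\<dots> = b' \<cdot> b \<cdot> (x \<cdot> a')" using dom by simp
  also have "\<dots> = x \<cdot> a'" using assms(2) dom by simp
  finally show ?thesis .
qed

lemma square_paste:
  assumes "b \<cdot> x = y \<cdot> a" "b' \<cdot> y = z \<cdot> a'"
    and [simp]: "x \<in> Arr C" "y \<in> Arr C" "z \<in> Arr C" "a \<in> Arr C" "b \<in> Arr C" "a' \<in> Arr C" "b' \<in> Arr C"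
    "Cod C x = Dom C b" "Cod C a = Dom C y" "Cod C y = Dom C b'" "Cod C a' = Dom C z"
    "Dom C b' = Cod C b" "Dom C a' = Cod C a"
  shows "b' \<cdot> b \<cdot> x = z \<cdot> (a' \<cdot> a)"
proof -
  have "b' \<cdot> b \<cdot> x = b' \<cdot> (y \<cdot> a)" using assms(1) by simp
  also have "\<dots> = b' \<cdot> y \<cdot> a" using assms(10-14) by simp
  also have "\<dots> = z \<cdot> (a' \<cdot> a)" using assms(2) by simp
  finally show ?thesis .
qed

lemma arr_inv_eq:
  assumes "is_iso C f" "g \<in> Arr C" "Dom C g = Cod C f" "g \<cdot> f = Ide C (Dom C f)"
  shows "arr_inv C f = g"
proof -
  note f = arr_inv_props[OF assms(1)]
  have [simp]: "f \<in> Arr C" using assms(1) by (simp add: is_iso_def)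
  have "Cod C g = Dom C f" using Comp_Arr(3)[of f g] assms(2-4) by simp
  then have "g = g \<cdot> (f \<cdot> arr_inv C f)" using f(5) assms(2,3) by simp
  also have "\<dots> = g \<cdot> f \<cdot> arr_inv C f" using f(1-3) assms(2,3) by simp
  also have "\<dots> = arr_inv C f" using assms(4) f(1-3) by simp
  finally show ?thesis by simp
qed

end

lemma left_triangle_iso_refl:
  assumes "cat_functor C C \<Omega>" "left_triangle C \<Omega> t"
  shows "left_triangle_iso C \<Omega> t t"
proof -
  interpret cat_functor C C \<Omega> by fact
  obtain h g f where t: "t = (h, g, f)" by (cases t)
  show ?thesis
    unfolding left_triangle_iso_def t
    by (rule exI[of _ "Ide C (Dom C g)"], rule exI[of _ "Ide C (Dom C f)"],
        rule exI[of _ "Ide C (Cod C f)"])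
      (use assms(2) in \<open>auto simp: t Hom_iff intro!: src.is_iso_Ide\<close>)
qed

lemma left_triangle_mor_Comp:
  assumes "cat_functor C C \<Omega>"
    "left_triangle_mor C \<Omega> t t' (\<gamma>, \<beta>, \<alpha>)" "left_triangle_mor C \<Omega> t' t'' (\<gamma>', \<beta>', \<alpha>')"
  shows "left_triangle_mor C \<Omega> t t'' (\<gamma>' \<cdot>\<^bsub>C\<^esub> \<gamma>, \<beta>' \<cdot>\<^bsub>C\<^esub> \<beta>, \<alpha>' \<cdot>\<^bsub>C\<^esub> \<alpha>)"
proof -
  interpret cat_functor C C \<Omega> by fact
  obtain h g f h' g' f' h'' g'' f'' where t: "t = (h, g, f)" "t' = (h', g', f')" "t'' = (h'', g'', f'')"
    by (metis prod_cases3)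
  note a = assms(2,3)[unfolded t left_triangle_mor.simps left_triangle.simps Hom_iff]
  have "\<gamma>' \<cdot>\<^bsub>C\<^esub> \<gamma> \<cdot>\<^bsub>C\<^esub> h = h'' \<cdot>\<^bsub>C\<^esub> (FArr \<Omega> \<alpha>' \<cdot>\<^bsub>C\<^esub> FArr \<Omega> \<alpha>)"
    by (rule src.square_paste[where y = h']) (use a in simp_all)
  moreover have "\<beta>' \<cdot>\<^bsub>C\<^esub> \<beta> \<cdot>\<^bsub>C\<^esub> g = g'' \<cdot>\<^bsub>C\<^esub> (\<gamma>' \<cdot>\<^bsub>C\<^esub> \<gamma>)"
    by (rule src.square_paste[where y = g']) (use a in simp_all)
  moreover have "\<alpha>' \<cdot>\<^bsub>C\<^esub> \<alpha> \<cdot>\<^bsub>C\<^esub> f = f'' \<cdot>\<^bsub>C\<^esub> (\<beta>' \<cdot>\<^bsub>C\<^esub> \<beta>)"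
    by (rule src.square_paste[where y = f']) (use a in simp_all)
  ultimately show ?thesis
    unfolding t left_triangle_mor.simps left_triangle.simps Hom_iff
    using a by (simp del: src.Comp_Arr_assoc)
qed

lemma left_triangle_iso_trans:
  assumes "cat_functor C C \<Omega>" "left_triangle_iso C \<Omega> t t'" "left_triangle_iso C \<Omega> t' t''"
  shows "left_triangle_iso C \<Omega> t t''"
proof -
  interpret cat_functor C C \<Omega> by fact
  obtain \<gamma> \<beta> \<alpha> where m: "left_triangle_mor C \<Omega> t t' (\<gamma>, \<beta>, \<alpha>)"
    and i: "is_iso C \<gamma>" "is_iso C \<beta>" "is_iso C \<alpha>"
    using assms(2) unfolding left_triangle_iso_def by auto
  obtain \<gamma>' \<beta>' \<alpha>' where m': "left_triangle_mor C \<Omega> t' t'' (\<gamma>', \<beta>', \<alpha>')"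
    and i': "is_iso C \<gamma>'" "is_iso C \<beta>'" "is_iso C \<alpha>'"
    using assms(3) unfolding left_triangle_iso_def by auto
  have c: "Cod C \<gamma> = Dom C \<gamma>'" "Cod C \<beta> = Dom C \<beta>'" "Cod C \<alpha> = Dom C \<alpha>'"
    using m m' by (cases t; cases t'; cases t''; simp add: Hom_iff)+
  show ?thesis
    unfolding left_triangle_iso_def
    using left_triangle_mor_Comp[OF assms(1) m m'] src.is_iso_Comp[OF i(1) i'(1) c(1)]
      src.is_iso_Comp[OF i(2) i'(2) c(2)] src.is_iso_Comp[OF i(3) i'(3) c(3)] by blast
qed

lemma left_triangle_mor_arr_inv:
  assumes "cat_functor C C \<Omega>" "left_triangle_mor C \<Omega> t t' (\<gamma>, \<beta>, \<alpha>)"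
    "is_iso C \<gamma>" "is_iso C \<beta>" "is_iso C \<alpha>"
  shows "left_triangle_mor C \<Omega> t' t (arr_inv C \<gamma>, arr_inv C \<beta>, arr_inv C \<alpha>)"
proof -
  interpret cat_functor C C \<Omega> by fact
  obtain h g f h' g' f' where t: "t = (h, g, f)" "t' = (h', g', f')" by (metis prod_cases3)
  note a = assms(2)[unfolded t left_triangle_mor.simps left_triangle.simps Hom_iff]
  note inv = src.arr_inv_props[OF assms(3)] src.arr_inv_props[OF assms(4)]
    src.arr_inv_props[OF assms(5)]
  have \<Omega>\<alpha>: "FArr \<Omega> \<alpha> \<cdot>\<^bsub>C\<^esub> FArr \<Omega> (arr_inv C \<alpha>) = Ide C (Cod C (FArr \<Omega> \<alpha>))"
    using FArr_Comp_Arr[of "arr_inv C \<alpha>" \<alpha>] inv a by simp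
  have "arr_inv C \<gamma> \<cdot>\<^bsub>C\<^esub> h' = h \<cdot>\<^bsub>C\<^esub> FArr \<Omega> (arr_inv C \<alpha>)"
    by (rule src.square_inverse[where b = \<gamma> and a = "FArr \<Omega> \<alpha>"]) (use a inv \<Omega>\<alpha> in simp_all)
  moreover have "arr_inv C \<beta> \<cdot>\<^bsub>C\<^esub> g' = g \<cdot>\<^bsub>C\<^esub> arr_inv C \<gamma>"
    by (rule src.square_inverse[where b = \<beta> and a = \<gamma>]) (use a inv in simp_all)
  moreover have "arr_inv C \<alpha> \<cdot>\<^bsub>C\<^esub> f' = f \<cdot>\<^bsub>C\<^esub> arr_inv C \<beta>"
    by (rule src.square_inverse[where b = \<alpha> and a = \<beta>]) (use a inv in simp_all)
  ultimately show ?thesis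
    unfolding t left_triangle_mor.simps left_triangle.simps Hom_iff
    using a inv by simp
qed

lemma left_triangle_iso_sym:
  assumes "cat_functor C C \<Omega>" "left_triangle_iso C \<Omega> t t'"
  shows "left_triangle_iso C \<Omega> t' t"
proof -
  interpret cat_functor C C \<Omega> by fact
  show ?thesis
    using assms(2) left_triangle_mor_arr_inv[OF assms(1)] src.is_iso_arr_inv
    unfolding left_triangle_iso_def by blast
qed

text \<open>Rotation of triangles respects isomorphism; the sign passes through as \<open>\<Omega>\<close> is additive.\<close>

lemma left_triangle_iso_rotate:
  assumes "additive_category C" "additive_functor C C \<Omega>" "left_triangle_iso C \<Omega> (h, g, f) (h', g', f')"
  shows "left_triangle_iso C \<Omega> (arr_minus C (FArr \<Omega> f), h, g) (arr_minus C (FArr \<Omega> f'), h', g')"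
proof -
  interpret additive_category C by fact
  interpret shift: additive_functor C C \<Omega> by fact
  obtain \<gamma> \<beta> \<alpha> where m: "left_triangle_mor C \<Omega> (h, g, f) (h', g', f') (\<gamma>, \<beta>, \<alpha>)"
    and i: "is_iso C \<gamma>" "is_iso C \<beta>" "is_iso C \<alpha>"
    using assms(3) unfolding left_triangle_iso_def by auto
  note a = m[unfolded left_triangle_mor.simps left_triangle.simps Hom_iff]
  have hom: "FArr \<Omega> f \<in> Hom C (FOb \<Omega> (Dom C f)) (FOb \<Omega> (Cod C f))"
    "FArr \<Omega> \<alpha> \<in> Hom C (FOb \<Omega> (Cod C f)) (FOb \<Omega> (Cod C f'))"
    "FArr \<Omega> \<beta> \<in> Hom C (FOb \<Omega> (Dom C f)) (FOb \<Omega> (Dom C f'))"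
    "FArr \<Omega> f' \<in> Hom C (FOb \<Omega> (Dom C f')) (FOb \<Omega> (Cod C f'))"
    using a by (simp_all add: Hom_iff)
  have "FArr \<Omega> \<alpha> \<cdot>\<^bsub>C\<^esub> FArr \<Omega> f = FArr \<Omega> f' \<cdot>\<^bsub>C\<^esub> FArr \<Omega> \<beta>"
    by (rule shift.FArr_square) (use a in simp_all)
  then have "FArr \<Omega> \<alpha> \<cdot>\<^bsub>C\<^esub> arr_minus C (FArr \<Omega> f) = arr_minus C (FArr \<Omega> f') \<cdot>\<^bsub>C\<^esub> FArr \<Omega> \<beta>"
    using Comp_arr_minus(1)[OF hom(1,2)] Comp_arr_minus(2)[OF hom(3,4)] by simp
  then have "left_triangle_mor C \<Omega> (arr_minus C (FArr \<Omega> f), h, g) (arr_minus C (FArr \<Omega> f'), h', g')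
      (FArr \<Omega> \<alpha>, \<gamma>, \<beta>)"
    unfolding left_triangle_mor.simps left_triangle.simps Hom_iff using a by simp
  then show ?thesis
    unfolding left_triangle_iso_def using i shift.FArr_is_iso by blast
qed


section \<open>The left triangulated structure induced by a left coreflective functor\<close>

context left_coreflective
begin

text \<open>The endofunctor of \<open>X\<close> and the class of left triangles that are induced by \<open>i\<close>.\<close>

abbreviation U where "U \<equiv> Q \<circ>\<^sub>F \<Omega> \<circ>\<^sub>F i"

abbreviation \<L>\<^sub>X where "\<L>\<^sub>X \<equiv> induced_left_triangles \<Omega> \<L> X i Q \<eta>"

lemma additive_category_C: "additive_category C" and additive_category_X: "additive_category X"
  by unfold_locales

lemma additive_Q: "additive_functor C X Q"
  by (rule adj.right_adjoint_additive[OF additive_category_X additive_category_C])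

lemma additive_i: "additive_functor X C i"
  by (rule adj.fully_faithful_left_adjoint_additive[OF additive_category_X additive_category_C
        fully_faithful])

lemma additive_U: "additive_functor X X U"
proof (rule additive_functor_comp_fun[OF additive_i], rule additive_functor_comp_fun[OF _ additive_Q])
  show "additive_functor C C \<Omega>" by unfold_locales
qed

lemma functor_U: "cat_functor X X U"
  using additive_U by (rule additive_functor.axioms(1))

text \<open>The inverse of the unit, which exists on the objects of \<open>X\<close> because \<open>i\<close> is fully faithful.\<close>

abbreviation \<eta>inv where "\<eta>inv A \<equiv> arr_inv X (\<eta> A)"

lemma unit_iso: "A \<in> Ob X \<Longrightarrow> is_iso X (\<eta> A)"
  by (rule adj.unit_is_iso[OF fully_faithful])

lemma \<eta>inv_Arr [simp]:
  assumes "A \<in> Ob X"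
  shows "\<eta>inv A \<in> Arr X" "Dom X (\<eta>inv A) = FOb Q (FOb i A)" "Cod X (\<eta>inv A) = A"
    "\<eta>inv A \<cdot>\<^bsub>X\<^esub> \<eta> A = Ide X A" "\<eta> A \<cdot>\<^bsub>X\<^esub> \<eta>inv A = Ide X (FOb Q (FOb i A))" "is_iso X (\<eta>inv A)"
  using sub.arr_inv_props[OF unit_iso[OF assms]] sub.is_iso_arr_inv[OF unit_iso[OF assms]] assms
  by simp_all

lemma \<eta>inv_Q: "B \<in> Ob C \<Longrightarrow> \<eta>inv (FOb Q B) = FArr Q (\<epsilon> B)"
  by (rule sub.arr_inv_eq[OF unit_iso]) (simp_all add: adj.triangle_G)

lemma i_\<eta>inv:
  assumes "A \<in> Ob X" shows "FArr i (\<eta>inv A) = \<epsilon> (FOb i A)"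
proof -
  have "FArr i (\<eta> A) \<cdot>\<^bsub>C\<^esub> FArr i (\<eta>inv A) = FArr i (\<eta> A \<cdot>\<^bsub>X\<^esub> \<eta>inv A)"
    using assms by (simp del: \<eta>inv_Arr(5))
  then have "FArr i (\<eta> A) \<cdot>\<^bsub>C\<^esub> FArr i (\<eta>inv A) = Ide C (FOb i (FOb Q (FOb i A)))"
    using assms by simp
  then have "\<epsilon> (FOb i A) = \<epsilon> (FOb i A) \<cdot>\<^bsub>C\<^esub> (FArr i (\<eta> A) \<cdot>\<^bsub>C\<^esub> FArr i (\<eta>inv A))"
    using assms by simp
  also have "\<dots> = \<epsilon> (FOb i A) \<cdot>\<^bsub>C\<^esub> FArr i (\<eta> A) \<cdot>\<^bsub>C\<^esub> FArr i (\<eta>inv A)"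
    using assms by simp
  also have "\<dots> = FArr i (\<eta>inv A)" using assms adj.triangle_F[OF assms] by simp
  finally show ?thesis by simp
qed

lemma \<eta>inv_naturality:
  assumes "f \<in> Arr X"
  shows "f \<cdot>\<^bsub>X\<^esub> \<eta>inv (Dom X f) = \<eta>inv (Cod X f) \<cdot>\<^bsub>X\<^esub> FArr Q (FArr i f)"
  by (rule sub.square_inverse[symmetric, where b = "\<eta> (Cod X f)" and a = "\<eta> (Dom X f)"])
    (use assms adj.unit_naturality[OF assms] in simp_all)

lemma triangle_Arr:
  assumes "(h, g, f) \<in> \<L>"
  shows "h \<in> Arr C" "g \<in> Arr C" "f \<in> Arr C" "Dom C h = FOb \<Omega> (Cod C f)" "Cod C h = Dom C g"
    "Cod C g = Dom C f"
  using left_triangles[OF assms] by simp_all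

lemma induced_iso_closed:
  assumes "t \<in> \<L>\<^sub>X" "left_triangle_iso X U t t'"
  shows "t' \<in> \<L>\<^sub>X"
  using assms left_triangle_iso_trans[OF functor_U left_triangle_iso_sym[OF functor_U assms(2)]]
  unfolding induced_left_triangles_def by blast

text \<open>
  The standard triangle \<open>(Q h, \<eta>\<^sup>-\<^sup>1 \<cdot> Q g, f)\<close> over an arrow \<open>f\<close> of \<open>X\<close>; up to isomorphism, every
  induced triangle is of this form.
\<close>

lemma standard_left_triangle:
  assumes "(h, g, FArr i f) \<in> \<L>" "f \<in> Arr X"
  shows "left_triangle X U (FArr Q h, \<eta>inv (Dom X f) \<cdot>\<^bsub>X\<^esub> FArr Q g, f)"
  using triangle_Arr[OF assms(1)] assms(2) by simp

lemma standard_triangle: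
  assumes "(h, g, FArr i f) \<in> \<L>" "f \<in> Arr X"
  shows "(FArr Q h, \<eta>inv (Dom X f) \<cdot>\<^bsub>X\<^esub> FArr Q g, f) \<in> \<L>\<^sub>X"
  using assms left_triangle_iso_refl[OF functor_U standard_left_triangle[OF assms]]
  unfolding induced_left_triangles_def by blast

lemma induced_left_triangle:
  assumes "t \<in> \<L>\<^sub>X" shows "left_triangle X U t"
  using assms unfolding induced_left_triangles_def left_triangle_iso_def
  by (cases t) auto

text \<open>
  This is where coreflectivity enters: \<open>Q\<close> carries every left triangle of \<open>C\<close>, and not only those
  over an arrow in the image of \<open>i\<close>, to an induced triangle. Rotation and the octahedral axiom for
  \<open>\<L>\<^sub>X\<close> follow, as in both cases the triangle to be produced is the image of one that has no
  reason to end in the image of \<open>i\<close>.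
\<close>

lemma Q_image_triangle:
  assumes "(h, g, f) \<in> \<L>"
  shows "(FArr Q h \<cdot>\<^bsub>X\<^esub> FArr Q (FArr \<Omega> (\<epsilon> (Cod C f))), FArr Q g, FArr Q f) \<in> \<L>\<^sub>X"
proof -
  note a = triangle_Arr[OF assms]
  have "FArr i (FArr Q f) \<in> Arr C" using a by simp
  then obtain h' g' where t': "(h', g', FArr i (FArr Q f)) \<in> \<L>" using LT1_ex by blast
  note a' = triangle_Arr[OF t']
  have ob: "Cod C f \<in> Ob C" "Dom C f \<in> Ob C" using a by simp_all
  have "\<epsilon> (Dom C f) \<in> Hom C (Dom C (FArr i (FArr Q f))) (Dom C f)"
    "\<epsilon> (Cod C f) \<in> Hom C (Cod C (FArr i (FArr Q f))) (Cod C f)"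
    using a(3) by (simp_all add: Hom_iff)
  from LT3[OF t' assms this adj.counit_naturality[OF a(3)]]
  obtain t where t: "left_triangle_mor C \<Omega> (h', g', FArr i (FArr Q f)) (h, g, f)
      (t, \<epsilon> (Dom C f), \<epsilon> (Cod C f))" by blast
  \<comment> \<open>The standard triangle over \<open>Q f\<close> is isomorphic to the image of \<open>(h, g, f)\<close> by \<open>(Q t, 1, 1)\<close>.\<close>
  have iso: "is_iso X (FArr Q t)" by (rule coreflective[OF assms t' t])
  note b = t[unfolded left_triangle_mor.simps left_triangle.simps Hom_iff]
  have sq: "t \<cdot>\<^bsub>C\<^esub> h' = h \<cdot>\<^bsub>C\<^esub> FArr \<Omega> (\<epsilon> (Cod C f))" "\<epsilon> (Dom C f) \<cdot>\<^bsub>C\<^esub> g' = g \<cdot>\<^bsub>C\<^esub> t"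
    and tA: "t \<in> Arr C" "Dom C t = Dom C g'" "Cod C t = Dom C g"
    using b by simp_all
  have "FArr Q t \<cdot>\<^bsub>X\<^esub> FArr Q h' = FArr Q h \<cdot>\<^bsub>X\<^esub> FArr Q (FArr \<Omega> (\<epsilon> (Cod C f)))"
    by (rule adj.G.FArr_square[OF sq(1)]) (use a a' tA ob in simp_all)
  moreover have "FArr Q (\<epsilon> (Dom C f)) \<cdot>\<^bsub>X\<^esub> FArr Q g' = FArr Q g \<cdot>\<^bsub>X\<^esub> FArr Q t"
    by (rule adj.G.FArr_square[OF sq(2)]) (use a a' tA ob in simp_all)
  ultimately have "left_triangle_mor X U
      (FArr Q h', \<eta>inv (Dom X (FArr Q f)) \<cdot>\<^bsub>X\<^esub> FArr Q g', FArr Q f)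
      (FArr Q h \<cdot>\<^bsub>X\<^esub> FArr Q (FArr \<Omega> (\<epsilon> (Cod C f))), FArr Q g, FArr Q f)
      (FArr Q t, Ide X (FOb Q (Dom C f)), Ide X (FOb Q (Cod C f)))"
    unfolding left_triangle_mor.simps left_triangle.simps Hom_iff
    using a a' tA ob by (simp add: \<eta>inv_Q)
  then have "left_triangle_iso X U
      (FArr Q h', \<eta>inv (Dom X (FArr Q f)) \<cdot>\<^bsub>X\<^esub> FArr Q g', FArr Q f)
      (FArr Q h \<cdot>\<^bsub>X\<^esub> FArr Q (FArr \<Omega> (\<epsilon> (Cod C f))), FArr Q g, FArr Q f)"
    unfolding left_triangle_iso_def using iso sub.is_iso_Ide ob by (meson adj.G.FOb_in_Ob)
  then show ?thesis
    using induced_iso_closed[OF standard_triangle[OF t']] a by simp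
qed

lemma induced_LT1_ex:
  assumes "f \<in> Arr X" shows "\<exists>h g. (h, g, f) \<in> \<L>\<^sub>X"
proof -
  obtain h g where "(h, g, FArr i f) \<in> \<L>" using LT1_ex[of "FArr i f"] assms by auto
  from standard_triangle[OF this assms] show ?thesis by blast
qed

lemma induced_LT1_Ide:
  assumes A: "A \<in> Ob X" and Z: "zero_object X Z"
  shows "(Zero X (FOb U Z) A, Ide X A, Zero X A Z) \<in> \<L>\<^sub>X"
proof -
  have ZOb: "Z \<in> Ob X" and ZI: "Ide X Z = Zero X Z Z" using Z by (simp_all add: sub.zero_object_iff)
  note i0 = additive_functor_Zero[OF additive_category_X additive_category_C additive_i]
  note Q0 = additive_functor_Zero[OF additive_category_C additive_category_X additive_Q]
  have "Ide C (FOb i Z) = Zero C (FOb i Z) (FOb i Z)"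
    using ZI i0[OF ZOb ZOb] ZOb adj.F.FArr_Ide[OF ZOb] by simp
  then have "zero_object C (FOb i Z)" using ZOb by (simp add: zero_object_iff)
  then have "(Zero C (FOb \<Omega> (FOb i Z)) (FOb i A), Ide C (FOb i A), FArr i (Zero X A Z)) \<in> \<L>"
    using LT1_Ide[of "FOb i A" "FOb i Z"] A i0[OF A ZOb] by simp
  from standard_triangle[OF this]
  have std: "(Zero X (FOb U Z) (FOb Q (FOb i A)), \<eta>inv A, Zero X A Z) \<in> \<L>\<^sub>X"
    using A ZOb Q0 by simp
  have UZ: "FOb U Z \<in> Ob X" using ZOb by simp
  have \<eta>hom: "\<eta>inv A \<in> Hom X (FOb Q (FOb i A)) A" using A by (simp add: Hom_iff)
  have "left_triangle_mor X U (Zero X (FOb U Z) (FOb Q (FOb i A)), \<eta>inv A, Zero X A Z)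
      (Zero X (FOb U Z) A, Ide X A, Zero X A Z) (\<eta>inv A, Ide X A, Ide X Z)"
    unfolding left_triangle_mor.simps left_triangle.simps Hom_iff
    using A ZOb sub.Comp_Zero(1)[OF \<eta>hom UZ] by simp
  then have "left_triangle_iso X U (Zero X (FOb U Z) (FOb Q (FOb i A)), \<eta>inv A, Zero X A Z)
      (Zero X (FOb U Z) A, Ide X A, Zero X A Z)"
    unfolding left_triangle_iso_def using \<eta>inv_Arr(6)[OF A] sub.is_iso_Ide[OF A] sub.is_iso_Ide[OF ZOb]
    by blast
  then show ?thesis by (rule induced_iso_closed[OF std])
qed

lemma induced_triangle_cases:
  assumes "(h, g, f) \<in> \<L>\<^sub>X"
  obtains h' g' f' where "f' \<in> Arr X" "(h', g', FArr i f') \<in> \<L>"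
    "left_triangle_iso X U (h, g, f) (FArr Q h', \<eta>inv (Dom X f') \<cdot>\<^bsub>X\<^esub> FArr Q g', f')"
  using assms unfolding induced_left_triangles_def by blast

lemma induced_LT2:
  assumes "(h, g, f) \<in> \<L>\<^sub>X"
  shows "(arr_minus X (FArr U f), h, g) \<in> \<L>\<^sub>X"
proof -
  obtain h' g' f' where f': "f' \<in> Arr X" and t: "(h', g', FArr i f') \<in> \<L>"
    and iso: "left_triangle_iso X U (h, g, f) (FArr Q h', \<eta>inv (Dom X f') \<cdot>\<^bsub>X\<^esub> FArr Q g', f')"
    using assms by (rule induced_triangle_cases)
  note a = triangle_Arr[OF t]
  let ?B = "Dom X f'"
  have B: "?B \<in> Ob X" using f' by simp
  have Qm: "FArr Q (arr_minus C (FArr \<Omega> (FArr i f'))) = arr_minus X (FArr U f')"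
    using additive_functor_arr_minus[OF additive_category_C additive_category_X additive_Q] f' by simp
  \<comment> \<open>The image of the rotated triangle of \<open>C\<close> ends in \<open>Q(i B)\<close> instead of \<open>B\<close>; the unit corrects this.\<close>
  have "(FArr Q (arr_minus C (FArr \<Omega> (FArr i f'))) \<cdot>\<^bsub>X\<^esub> FArr Q (FArr \<Omega> (\<epsilon> (Cod C g'))),
      FArr Q h', FArr Q g') \<in> \<L>\<^sub>X"
    by (rule Q_image_triangle[OF LT2[OF t]])
  then have K: "(arr_minus X (FArr U f') \<cdot>\<^bsub>X\<^esub> FArr U (\<eta>inv ?B), FArr Q h', FArr Q g') \<in> \<L>\<^sub>X"
    using Qm a(6) f' i_\<eta>inv[OF B] by simp
  have mor: "left_triangle_mor X U (arr_minus X (FArr U f') \<cdot>\<^bsub>X\<^esub> FArr U (\<eta>inv ?B), FArr Q h', FArr Q g')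
      (arr_minus X (FArr U f'), FArr Q h', \<eta>inv ?B \<cdot>\<^bsub>X\<^esub> FArr Q g')
      (Ide X (FOb U (Cod X f')), Ide X (FOb Q (Dom C g')), \<eta>inv ?B)"
    unfolding left_triangle_mor.simps left_triangle.simps Hom_iff
    using a f' B by simp
  have ob: "FOb U (Cod X f') \<in> Ob X" "FOb Q (Dom C g') \<in> Ob X" using a f' by simp_all
  have "left_triangle_iso X U
      (arr_minus X (FArr U f') \<cdot>\<^bsub>X\<^esub> FArr U (\<eta>inv ?B), FArr Q h', FArr Q g')
      (arr_minus X (FArr U f'), FArr Q h', \<eta>inv ?B \<cdot>\<^bsub>X\<^esub> FArr Q g')"
    unfolding left_triangle_iso_def
    using mor \<eta>inv_Arr(6)[OF B] sub.is_iso_Ide[OF ob(1)] sub.is_iso_Ide[OF ob(2)] by blast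
  from induced_iso_closed[OF K this]
  have "(arr_minus X (FArr U f'), FArr Q h', \<eta>inv ?B \<cdot>\<^bsub>X\<^esub> FArr Q g') \<in> \<L>\<^sub>X" .
  then show ?thesis
    by (rule induced_iso_closed)
      (rule left_triangle_iso_sym[OF functor_U
          left_triangle_iso_rotate[OF additive_category_X additive_U iso]])
qed

lemma standard_LT3:
  assumes "(h, g, FArr i f) \<in> \<L>" "(h', g', FArr i f') \<in> \<L>" "f \<in> Arr X" "f' \<in> Arr X"
    "\<beta> \<in> Hom X (Dom X f) (Dom X f')" "\<alpha> \<in> Hom X (Cod X f) (Cod X f')" "\<alpha> \<cdot>\<^bsub>X\<^esub> f = f' \<cdot>\<^bsub>X\<^esub> \<beta>"
  shows "\<exists>\<gamma>. left_triangle_mor X U (FArr Q h, \<eta>inv (Dom X f) \<cdot>\<^bsub>X\<^esub> FArr Q g, f)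
    (FArr Q h', \<eta>inv (Dom X f') \<cdot>\<^bsub>X\<^esub> FArr Q g', f') (\<gamma>, \<beta>, \<alpha>)"
proof -
  note a = triangle_Arr[OF assms(1)] triangle_Arr[OF assms(2)] assms(5,6)[unfolded Hom_iff]
  have "FArr i \<alpha> \<cdot>\<^bsub>C\<^esub> FArr i f = FArr i f' \<cdot>\<^bsub>C\<^esub> FArr i \<beta>"
    by (rule adj.F.FArr_square[OF assms(7)]) (use a assms(3,4) in simp_all)
  then obtain \<gamma> where \<gamma>: "left_triangle_mor C \<Omega> (h, g, FArr i f) (h', g', FArr i f')
      (\<gamma>, FArr i \<beta>, FArr i \<alpha>)"
    using LT3[OF assms(1,2), of "FArr i \<beta>" "FArr i \<alpha>"] a assms(3,4) by (auto simp: Hom_iff)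
  note b = \<gamma>[unfolded left_triangle_mor.simps left_triangle.simps Hom_iff]
  have sq: "\<gamma> \<cdot>\<^bsub>C\<^esub> h = h' \<cdot>\<^bsub>C\<^esub> FArr \<Omega> (FArr i \<alpha>)" "FArr i \<beta> \<cdot>\<^bsub>C\<^esub> g = g' \<cdot>\<^bsub>C\<^esub> \<gamma>"
    using b by simp_all
  have 1: "FArr Q \<gamma> \<cdot>\<^bsub>X\<^esub> FArr Q h = FArr Q h' \<cdot>\<^bsub>X\<^esub> FArr U \<alpha>"
    using adj.G.FArr_square[OF sq(1)] a b by simp
  have 2: "FArr Q (FArr i \<beta>) \<cdot>\<^bsub>X\<^esub> FArr Q g = FArr Q g' \<cdot>\<^bsub>X\<^esub> FArr Q \<gamma>"
    by (rule adj.G.FArr_square[OF sq(2)]) (use a b assms in simp_all)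
  have "\<beta> \<cdot>\<^bsub>X\<^esub> (\<eta>inv (Dom X f) \<cdot>\<^bsub>X\<^esub> FArr Q g) = \<beta> \<cdot>\<^bsub>X\<^esub> \<eta>inv (Dom X f) \<cdot>\<^bsub>X\<^esub> FArr Q g"
    using a assms(3,4) by simp
  also have "\<dots> = \<eta>inv (Dom X f') \<cdot>\<^bsub>X\<^esub> FArr Q (FArr i \<beta>) \<cdot>\<^bsub>X\<^esub> FArr Q g"
    using \<eta>inv_naturality[of \<beta>] a by simp
  also have "\<dots> = \<eta>inv (Dom X f') \<cdot>\<^bsub>X\<^esub> (FArr Q g' \<cdot>\<^bsub>X\<^esub> FArr Q \<gamma>)"
    using 2 a assms(3,4) by simp
  also have "\<dots> = \<eta>inv (Dom X f') \<cdot>\<^bsub>X\<^esub> FArr Q g' \<cdot>\<^bsub>X\<^esub> FArr Q \<gamma>"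
    using a b assms(3,4) by simp
  finally have 3: "\<beta> \<cdot>\<^bsub>X\<^esub> (\<eta>inv (Dom X f) \<cdot>\<^bsub>X\<^esub> FArr Q g) = \<eta>inv (Dom X f') \<cdot>\<^bsub>X\<^esub> FArr Q g' \<cdot>\<^bsub>X\<^esub> FArr Q \<gamma>" .
  have "left_triangle_mor X U (FArr Q h, \<eta>inv (Dom X f) \<cdot>\<^bsub>X\<^esub> FArr Q g, f)
    (FArr Q h', \<eta>inv (Dom X f') \<cdot>\<^bsub>X\<^esub> FArr Q g', f') (FArr Q \<gamma>, \<beta>, \<alpha>)"
    unfolding left_triangle_mor.simps
    using 1 3 standard_left_triangle[OF assms(1,3)] standard_left_triangle[OF assms(2,4)] a b assms(3-7)
    by (simp del: sub.Comp_Arr_assoc left_triangle.simps add: Hom_iff)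
  then show ?thesis by blast
qed

lemma induced_LT3:
  assumes t: "(h, g, f) \<in> \<L>\<^sub>X" and t': "(h', g', f') \<in> \<L>\<^sub>X"
    and \<beta>: "\<beta> \<in> Hom X (Dom X f) (Dom X f')" and \<alpha>: "\<alpha> \<in> Hom X (Cod X f) (Cod X f')"
    and eq: "\<alpha> \<cdot>\<^bsub>X\<^esub> f = f' \<cdot>\<^bsub>X\<^esub> \<beta>"
  shows "\<exists>\<gamma>. left_triangle_mor X U (h, g, f) (h', g', f') (\<gamma>, \<beta>, \<alpha>)"
proof -
  obtain h0 g0 f0 where f0: "f0 \<in> Arr X" and t0: "(h0, g0, FArr i f0) \<in> \<L>"
    and iso: "left_triangle_iso X U (h, g, f) (FArr Q h0, \<eta>inv (Dom X f0) \<cdot>\<^bsub>X\<^esub> FArr Q g0, f0)"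
    using t by (rule induced_triangle_cases)
  obtain h1 g1 f1 where f1: "f1 \<in> Arr X" and t1: "(h1, g1, FArr i f1) \<in> \<L>"
    and iso': "left_triangle_iso X U (h', g', f') (FArr Q h1, \<eta>inv (Dom X f1) \<cdot>\<^bsub>X\<^esub> FArr Q g1, f1)"
    using t' by (rule induced_triangle_cases)
  let ?t0 = "(FArr Q h0, \<eta>inv (Dom X f0) \<cdot>\<^bsub>X\<^esub> FArr Q g0, f0)"
  let ?t1 = "(FArr Q h1, \<eta>inv (Dom X f1) \<cdot>\<^bsub>X\<^esub> FArr Q g1, f1)"
  obtain c b a where m0: "left_triangle_mor X U (h, g, f) ?t0 (c, b, a)"
    and i0: "is_iso X c" "is_iso X b" "is_iso X a"
    using iso unfolding left_triangle_iso_def by blast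
  obtain c' b' a' where m1: "left_triangle_mor X U (h', g', f') ?t1 (c', b', a')"
    and i1: "is_iso X c'" "is_iso X b'" "is_iso X a'"
    using iso' unfolding left_triangle_iso_def by blast
  note n0 = left_triangle_mor_arr_inv[OF functor_U m0 i0]
    and n1 = left_triangle_mor_arr_inv[OF functor_U m1 i1]
  note e = m0[unfolded left_triangle_mor.simps left_triangle.simps Hom_iff]
    m1[unfolded left_triangle_mor.simps left_triangle.simps Hom_iff]
  note e2 = n0[unfolded left_triangle_mor.simps left_triangle.simps Hom_iff]
  note v = sub.arr_inv_props[OF i0(2)] sub.arr_inv_props[OF i0(3)]
    sub.arr_inv_props[OF i1(2)] sub.arr_inv_props[OF i1(3)]
  \<comment> \<open>The arrows \<open>\<beta>\<close>, \<open>\<alpha>\<close> are transported to the standard triangles, and the solution there back.\<close>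
  define \<beta>' where "\<beta>' = b' \<cdot>\<^bsub>X\<^esub> \<beta> \<cdot>\<^bsub>X\<^esub> arr_inv X b"
  define \<alpha>' where "\<alpha>' = a' \<cdot>\<^bsub>X\<^esub> \<alpha> \<cdot>\<^bsub>X\<^esub> arr_inv X a"
  note ba = \<beta>[unfolded Hom_iff] \<alpha>[unfolded Hom_iff]
  have s1: "a' \<cdot>\<^bsub>X\<^esub> \<alpha> \<cdot>\<^bsub>X\<^esub> f = f1 \<cdot>\<^bsub>X\<^esub> (b' \<cdot>\<^bsub>X\<^esub> \<beta>)"
    by (rule sub.square_paste[where y = f', OF eq]) (use e ba in simp_all)
  have s2: "arr_inv X a \<cdot>\<^bsub>X\<^esub> f0 = f \<cdot>\<^bsub>X\<^esub> arr_inv X b" using e2 by simp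
  have s3: "\<alpha>' \<cdot>\<^bsub>X\<^esub> f0 = f1 \<cdot>\<^bsub>X\<^esub> \<beta>'"
    unfolding \<alpha>'_def \<beta>'_def
    by (rule sub.square_paste[where y = f, OF s2 s1]) (use e e2 ba in simp_all)
  obtain \<gamma> where \<gamma>: "left_triangle_mor X U ?t0 ?t1 (\<gamma>, \<beta>', \<alpha>')"
    using standard_LT3[OF t0 t1 f0 f1 _ _ s3] e ba v unfolding \<alpha>'_def \<beta>'_def
    by (auto simp: Hom_iff)
  have conj_back: "arr_inv X y' \<cdot>\<^bsub>X\<^esub> (y' \<cdot>\<^bsub>X\<^esub> x \<cdot>\<^bsub>X\<^esub> arr_inv X y \<cdot>\<^bsub>X\<^esub> y) = x"
    if iy: "is_iso X y'" "is_iso X y" and x: "x \<in> Arr X" "Dom X x = Dom X y" "Cod X x = Dom X y'"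
    for x y y'
  proof -
    note p = sub.arr_inv_props[OF iy(1)] sub.arr_inv_props[OF iy(2)]
    have ya: "y \<in> Arr X" "y' \<in> Arr X" using iy by (simp_all add: is_iso_def)
    have "arr_inv X y' \<cdot>\<^bsub>X\<^esub> (y' \<cdot>\<^bsub>X\<^esub> x \<cdot>\<^bsub>X\<^esub> arr_inv X y \<cdot>\<^bsub>X\<^esub> y)
        = arr_inv X y' \<cdot>\<^bsub>X\<^esub> (y' \<cdot>\<^bsub>X\<^esub> x)" using p x ya by simp
    also have "\<dots> = arr_inv X y' \<cdot>\<^bsub>X\<^esub> y' \<cdot>\<^bsub>X\<^esub> x" using p(1-3) x ya by simp
    finally show ?thesis using p(4) x by simp
  qed
  have "arr_inv X b' \<cdot>\<^bsub>X\<^esub> (\<beta>' \<cdot>\<^bsub>X\<^esub> b) = \<beta>" "arr_inv X a' \<cdot>\<^bsub>X\<^esub> (\<alpha>' \<cdot>\<^bsub>X\<^esub> a) = \<alpha>"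
    unfolding \<alpha>'_def \<beta>'_def by (rule conj_back; use i0 i1 e ba in simp)+
  then show ?thesis
    using left_triangle_mor_Comp[OF functor_U left_triangle_mor_Comp[OF functor_U m0 \<gamma>] n1] by auto
qed

lemma induced_LT4:
  assumes g: "g \<in> Arr X" and f: "f \<in> Arr X" and gf: "Cod X g = Dom X f"
  shows "\<exists>m k n h p l. (m, k, g) \<in> \<L>\<^sub>X \<and> (n, h, f \<cdot>\<^bsub>X\<^esub> g) \<in> \<L>\<^sub>X \<and> (p, l, f) \<in> \<L>\<^sub>X \<and>
    (\<exists>\<alpha> \<in> Hom X (Dom X k) (Dom X h). \<exists>\<beta> \<in> Hom X (Dom X h) (Dom X l).
      \<alpha> \<cdot>\<^bsub>X\<^esub> m = n \<cdot>\<^bsub>X\<^esub> FArr U f \<and> h \<cdot>\<^bsub>X\<^esub> \<alpha> = k \<and> \<beta> \<cdot>\<^bsub>X\<^esub> n = p \<and> l \<cdot>\<^bsub>X\<^esub> \<beta> = g \<cdot>\<^bsub>X\<^esub> h \<and>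
      (m \<cdot>\<^bsub>X\<^esub> FArr U l, \<alpha>, \<beta>) \<in> \<L>\<^sub>X)"
proof -
  have 1: "FArr i g \<in> Arr C" "FArr i f \<in> Arr C" "Cod C (FArr i g) = Dom C (FArr i f)"
    using g f gf by simp_all
  obtain m k n h p l \<alpha> \<beta> where t: "(m, k, FArr i g) \<in> \<L>" "(n, h, FArr i (f \<cdot>\<^bsub>X\<^esub> g)) \<in> \<L>"
      "(p, l, FArr i f) \<in> \<L>"
    and \<alpha>: "\<alpha> \<in> Hom C (Dom C k) (Dom C h)" and \<beta>: "\<beta> \<in> Hom C (Dom C h) (Dom C l)"
    and e: "\<alpha> \<cdot>\<^bsub>C\<^esub> m = n \<cdot>\<^bsub>C\<^esub> FArr \<Omega> (FArr i f)" "h \<cdot>\<^bsub>C\<^esub> \<alpha> = k" "\<beta> \<cdot>\<^bsub>C\<^esub> n = p"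
      "l \<cdot>\<^bsub>C\<^esub> \<beta> = FArr i g \<cdot>\<^bsub>C\<^esub> h"
    and t4: "(m \<cdot>\<^bsub>C\<^esub> FArr \<Omega> l, \<alpha>, \<beta>) \<in> \<L>"
    using LT4[OF 1] g f gf by auto
  note a = triangle_Arr[OF t(1)] triangle_Arr[OF t(2)] triangle_Arr[OF t(3)]
    \<alpha>[unfolded Hom_iff] \<beta>[unfolded Hom_iff]
  let ?k = "\<eta>inv (Dom X g) \<cdot>\<^bsub>X\<^esub> FArr Q k" and ?h = "\<eta>inv (Dom X g) \<cdot>\<^bsub>X\<^esub> FArr Q h"
    and ?l = "\<eta>inv (Dom X f) \<cdot>\<^bsub>X\<^esub> FArr Q l"
  have T: "(FArr Q m, ?k, g) \<in> \<L>\<^sub>X" "(FArr Q n, ?h, f \<cdot>\<^bsub>X\<^esub> g) \<in> \<L>\<^sub>X" "(FArr Q p, ?l, f) \<in> \<L>\<^sub>X"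
    using standard_triangle[OF t(1)] standard_triangle[OF t(2)] standard_triangle[OF t(3)] g f gf
    by simp_all
  have E1: "FArr Q \<alpha> \<cdot>\<^bsub>X\<^esub> FArr Q m = FArr Q n \<cdot>\<^bsub>X\<^esub> FArr U f"
    using adj.G.FArr_square[OF e(1)] a f g gf by simp
  have "FArr Q h \<cdot>\<^bsub>X\<^esub> FArr Q \<alpha> = FArr Q k"
    using adj.G.FArr_Comp_Arr[of \<alpha> h] a(1-18) \<alpha>[unfolded Hom_iff] unfolding e(2) by simp
  then have E2: "?h \<cdot>\<^bsub>X\<^esub> FArr Q \<alpha> = ?k" using a f g gf by simp
  have E3: "FArr Q \<beta> \<cdot>\<^bsub>X\<^esub> FArr Q n = FArr Q p"
    using adj.G.FArr_Comp_Arr[of n \<beta>] a \<beta>[unfolded Hom_iff] unfolding e(3) by simp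
  have Qe: "FArr Q l \<cdot>\<^bsub>X\<^esub> FArr Q \<beta> = FArr Q (FArr i g) \<cdot>\<^bsub>X\<^esub> FArr Q h"
    using adj.G.FArr_square[OF e(4)] a f g gf by simp
  have "?l \<cdot>\<^bsub>X\<^esub> FArr Q \<beta> = \<eta>inv (Dom X f) \<cdot>\<^bsub>X\<^esub> FArr Q (FArr i g) \<cdot>\<^bsub>X\<^esub> FArr Q h"
    using Qe a f g gf by simp
  also have "\<dots> = g \<cdot>\<^bsub>X\<^esub> \<eta>inv (Dom X g) \<cdot>\<^bsub>X\<^esub> FArr Q h"
    using \<eta>inv_naturality[OF g] gf by simp
  also have "\<dots> = g \<cdot>\<^bsub>X\<^esub> ?h" using a f g gf by simp
  finally have E4: "?l \<cdot>\<^bsub>X\<^esub> FArr Q \<beta> = g \<cdot>\<^bsub>X\<^esub> ?h" .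
  have ob: "Dom C l \<in> Ob C" "Dom X f \<in> Ob X" using a f by simp_all
  \<comment> \<open>The first arrow of \<open>Q_image_triangle\<close> is the one required since \<open>l \<cdot> \<epsilon>\<close> is the image of \<open>?l\<close>.\<close>
  have "l \<cdot>\<^bsub>C\<^esub> \<epsilon> (Dom C l) = \<epsilon> (FOb i (Dom X f)) \<cdot>\<^bsub>C\<^esub> FArr i (FArr Q l)"
    using adj.counit_naturality[of l] a f by simp
  also have "\<dots> = FArr i ?l" using a f i_\<eta>inv[OF ob(2)] by simp
  finally have l\<epsilon>: "l \<cdot>\<^bsub>C\<^esub> \<epsilon> (Dom C l) = FArr i ?l" .
  have "FArr Q (FArr \<Omega> l) \<cdot>\<^bsub>X\<^esub> FArr Q (FArr \<Omega> (\<epsilon> (Dom C l))) = FArr Q (FArr \<Omega> (l \<cdot>\<^bsub>C\<^esub> \<epsilon> (Dom C l)))"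
    using a ob by simp
  then have Ul: "FArr Q (FArr \<Omega> l) \<cdot>\<^bsub>X\<^esub> FArr Q (FArr \<Omega> (\<epsilon> (Dom C l))) = FArr U ?l"
    unfolding l\<epsilon> by simp
  have "(FArr Q (m \<cdot>\<^bsub>C\<^esub> FArr \<Omega> l) \<cdot>\<^bsub>X\<^esub> FArr Q (FArr \<Omega> (\<epsilon> (Cod C \<beta>))), FArr Q \<alpha>, FArr Q \<beta>) \<in> \<L>\<^sub>X"
    by (rule Q_image_triangle[OF t4])
  moreover have "FArr Q (m \<cdot>\<^bsub>C\<^esub> FArr \<Omega> l) \<cdot>\<^bsub>X\<^esub> FArr Q (FArr \<Omega> (\<epsilon> (Cod C \<beta>)))
      = FArr Q m \<cdot>\<^bsub>X\<^esub> (FArr Q (FArr \<Omega> l) \<cdot>\<^bsub>X\<^esub> FArr Q (FArr \<Omega> (\<epsilon> (Dom C l))))"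
    using a g f gf ob by simp
  ultimately have T4: "(FArr Q m \<cdot>\<^bsub>X\<^esub> FArr U ?l, FArr Q \<alpha>, FArr Q \<beta>) \<in> \<L>\<^sub>X"
    unfolding Ul by simp
  have "FArr Q \<alpha> \<in> Hom X (Dom X ?k) (Dom X ?h)" "FArr Q \<beta> \<in> Hom X (Dom X ?h) (Dom X ?l)"
    using a f g gf by (simp_all add: Hom_iff)
  with T E1 E2 E3 E4 T4 show ?thesis by blast
qed

lemma induced_left_triangulated: "left_triangulated X U \<L>\<^sub>X"
proof -
  interpret UA: additive_functor X X U by (rule additive_U)
  show ?thesis
  proof unfold_locales
    show "\<exists>\<gamma>. left_triangle_mor X U (h, g, f) (h', g', f') (\<gamma>, \<beta>, \<alpha>)"
      if "(h, g, f) \<in> \<L>\<^sub>X" "(h', g', f') \<in> \<L>\<^sub>X" "\<beta> \<in> Hom X (Dom X f) (Dom X f')"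
        "\<alpha> \<in> Hom X (Cod X f) (Cod X f')" "\<alpha> \<cdot>\<^bsub>X\<^esub> f = f' \<cdot>\<^bsub>X\<^esub> \<beta>" for h g f h' g' f' \<alpha> \<beta>
      using that by (rule induced_LT3)
  qed (rule induced_left_triangle induced_iso_closed induced_LT1_ex induced_LT1_Ide induced_LT2
      induced_LT4; assumption)+
qed

end


section \<open>Duality\<close>

lemma op_cat_simps [simp]:
  "Ob (op_cat C) = Ob C" "Arr (op_cat C) = Arr C" "Dom (op_cat C) = Cod C" "Cod (op_cat C) = Dom C"
  "Ide (op_cat C) = Ide C" "g \<cdot>\<^bsub>op_cat C\<^esub> f = f \<cdot>\<^bsub>C\<^esub> g"
  by (simp_all add: op_cat_def)

lemma Hom_op_cat [simp]: "Hom (op_cat C) A B = Hom C B A"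
  by (auto simp: Hom_def)

lemma is_iso_op_cat [simp]: "is_iso (op_cat C) f \<longleftrightarrow> is_iso C f"
  by (auto simp: is_iso_def)

lemma arr_inv_op_cat [simp]: "arr_inv (op_cat C) f = arr_inv C f"
  unfolding arr_inv_def by (simp add: conj_commute)

lemma left_triangle_op_cat:
  "left_triangle (op_cat C) \<Sigma> (h, g, f) \<longleftrightarrow> right_triangle C \<Sigma> (f, g, h)"
  by auto

lemma left_triangle_mor_op_cat:
  "left_triangle_mor (op_cat C) \<Sigma> (h, g, f) (h', g', f') (\<gamma>, \<beta>, \<alpha>) \<longleftrightarrow>
    right_triangle_mor C \<Sigma> (f', g', h') (f, g, h) (\<alpha>, \<beta>, \<gamma>)"
  unfolding left_triangle_mor.simps right_triangle_mor.simps left_triangle_op_cat by auto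

lemma left_triangle_iso_op_cat:
  "left_triangle_iso (op_cat C) \<Sigma> (h, g, f) (h', g', f') \<longleftrightarrow>
    right_triangle_iso C \<Sigma> (f', g', h') (f, g, h)"
  unfolding left_triangle_iso_def right_triangle_iso_def left_triangle_mor_op_cat is_iso_op_cat by blast

text \<open>
  Both sides consist of the triangles isomorphic to a standard one. The reversal of arrows turns an
  isomorphism to the standard triangle into one from it, whence the appeal to symmetry.
\<close>

lemma op_triangles_induced_right_triangles:
  assumes "right_reflective D \<Sigma> \<R> X j R \<rho> \<theta>"
  shows "op_triangles (induced_right_triangles \<Sigma> \<R> X j R \<theta>)
    = induced_left_triangles \<Sigma> (op_triangles \<R>) (op_cat X) j R \<theta>"
proof -
  interpret op: left_coreflective "op_cat D" \<Sigma> "op_triangles \<R>" "op_cat X" j R \<theta> \<rho>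
    using assms by (simp add: right_reflective_def)
  let ?S = "R \<circ>\<^sub>F \<Sigma> \<circ>\<^sub>F j"
  have sym: "left_triangle_iso (op_cat X) ?S t t' \<longleftrightarrow> left_triangle_iso (op_cat X) ?S t' t" for t t'
    using left_triangle_iso_sym[OF op.functor_U] by blast
  have "(h, g, f) \<in> op_triangles (induced_right_triangles \<Sigma> \<R> X j R \<theta>) \<longleftrightarrow>
    (h, g, f) \<in> induced_left_triangles \<Sigma> (op_triangles \<R>) (op_cat X) j R \<theta>" for h g f
  proof -
    have "(h, g, f) \<in> op_triangles (induced_right_triangles \<Sigma> \<R> X j R \<theta>) \<longleftrightarrow>
      (\<exists>f' g' h'. f' \<in> Arr X \<and> (FArr j f', g', h') \<in> \<R> \<and> left_triangle_iso (op_cat X) ?S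
        (FArr R h', FArr R g' \<cdot>\<^bsub>X\<^esub> arr_inv X (\<theta> (Cod X f')), f') (h, g, f))"
      unfolding op_triangles_def induced_right_triangles_def left_triangle_iso_op_cat by simp
    also have "\<dots> \<longleftrightarrow> (h, g, f) \<in> induced_left_triangles \<Sigma> (op_triangles \<R>) (op_cat X) j R \<theta>"
      unfolding op_triangles_def induced_left_triangles_def sym[of _ "(h, g, f)"]
      by auto
    finally show ?thesis .
  qed
  then show ?thesis by auto
qed

lemma induced_right_triangulated:
  assumes "right_reflective D \<Sigma> \<R> X j R \<rho> \<theta>"
  shows "right_triangulated X (R \<circ>\<^sub>F \<Sigma> \<circ>\<^sub>F j) (induced_right_triangles \<Sigma> \<R> X j R \<theta>)"
  using left_coreflective.induced_left_triangulated[OF assms[unfolded right_reflective_def]]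
  unfolding right_triangulated_def op_triangles_induced_right_triangles[OF assms] .

lemma right_triangulated_triangle:
  assumes "right_triangulated C \<Sigma> \<R>" "(f, g, h) \<in> \<R>"
  shows "right_triangle C \<Sigma> (f, g, h)"
  using left_triangulated.left_triangles[OF assms(1)[unfolded right_triangulated_def], of "(h, g, f)"]
    assms(2) unfolding left_triangle_op_cat by (simp add: op_triangles_def)

text \<open>The axioms (LT1) and (LT3) of the opposite category, read as statements on right triangles.\<close>

lemma right_triangulated_ex:
  assumes "right_triangulated C \<Sigma> \<R>" "f \<in> Arr C"
  shows "\<exists>g h. (f, g, h) \<in> \<R>"
  using left_triangulated.LT1_ex[OF assms(1)[unfolded right_triangulated_def], of f] assms(2)
  by (auto simp: op_triangles_def)

lemma right_triangulated_mor:
  assumes "right_triangulated C \<Sigma> \<R>" "(f, g, h) \<in> \<R>" "(f', g', h') \<in> \<R>"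
    "\<alpha> \<in> Hom C (Dom C f) (Dom C f')" "\<beta> \<in> Hom C (Cod C f) (Cod C f')"
    "\<beta> \<cdot>\<^bsub>C\<^esub> f = f' \<cdot>\<^bsub>C\<^esub> \<alpha>"
  shows "\<exists>\<gamma>. right_triangle_mor C \<Sigma> (f, g, h) (f', g', h') (\<alpha>, \<beta>, \<gamma>)"
  using left_triangulated.LT3[OF assms(1)[unfolded right_triangulated_def],
      of h' g' f' h g f \<beta> \<alpha>] assms(2-6)
  unfolding left_triangle_mor_op_cat
  by (simp add: op_triangles_def del: right_triangle_mor.simps)


section \<open>The pretriangulated structure of a prile\<close>

context prile
begin

text \<open>The adjoint pair of endofunctors of \<open>X\<close> and its two classes of induced triangles.\<close>

abbreviation S where "S \<equiv> R \<circ>\<^sub>F \<Sigma> \<circ>\<^sub>F j"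

abbreviation U where "U \<equiv> Q \<circ>\<^sub>F \<Omega> \<circ>\<^sub>F i"

abbreviation \<L>\<^sub>X where "\<L>\<^sub>X \<equiv> induced_left_triangles \<Omega> \<L> X i Q \<eta>\<^sub>i"

abbreviation \<R>\<^sub>X where "\<R>\<^sub>X \<equiv> induced_right_triangles \<Sigma> \<R> X j R \<theta>"

lemma left_triangulated_X: "left_triangulated X U \<L>\<^sub>X"
  by (rule left_coreflective.induced_left_triangulated[OF left_coreflective])

lemma right_triangulated_X: "right_triangulated X S \<R>\<^sub>X"
  by (rule induced_right_triangulated[OF right_reflective])

text \<open>
  The first condition on a prile is the case \<open>\<alpha> = 1\<close>, \<open>\<beta> = 1\<close>. In general, \<open>f'\<close> is completed to a
  right triangle \<open>(f', g'', h'')\<close>. The pair \<open>(\<alpha>, \<beta>)\<close> extends to a morphism from \<open>(f, g, h)\<close> to it,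
  and the special case relates it to \<open>(f', g', h')\<close>; the filler is the composite.
\<close>

lemma right_to_left_fill:
  assumes r: "(f, g, h) \<in> \<R>\<^sub>X" and l: "(f', g', h') \<in> \<L>\<^sub>X"
    and \<alpha>: "\<alpha> \<in> Hom X (Dom X f) (FOb U (Cod X h'))" and \<beta>: "\<beta> \<in> Hom X (Cod X f) (Cod X f')"
    and eq: "\<beta> \<cdot>\<^bsub>X\<^esub> f = f' \<cdot>\<^bsub>X\<^esub> \<alpha>"
  shows "\<exists>\<delta> \<in> Hom X (Cod X g) (Cod X g').
    \<delta> \<cdot>\<^bsub>X\<^esub> g = g' \<cdot>\<^bsub>X\<^esub> \<beta> \<and> h' \<cdot>\<^bsub>X\<^esub> \<delta> = \<epsilon> (Cod X h') \<cdot>\<^bsub>X\<^esub> FArr S \<alpha> \<cdot>\<^bsub>X\<^esub> h"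
proof -
  interpret X: left_triangulated X U \<L>\<^sub>X by (rule left_triangulated_X)
  interpret SU: adjunction X X S U \<eta> \<epsilon> by (rule adjoint_pair)
  note a = X.left_triangles[OF l, unfolded left_triangle.simps]
    right_triangulated_triangle[OF right_triangulated_X r, unfolded right_triangle.simps]
    \<alpha>[unfolded Hom_iff] \<beta>[unfolded Hom_iff]
  have f': "f' \<in> Arr X" using a by blast
  obtain g'' h'' where r'': "(f', g'', h'') \<in> \<R>\<^sub>X"
    using right_triangulated_ex[OF right_triangulated_X f'] by blast
  note a'' = right_triangulated_triangle[OF right_triangulated_X r'', unfolded right_triangle.simps]
  have "\<alpha> \<in> Hom X (Dom X f) (Dom X f')" using \<alpha> a by simp
  then obtain \<gamma> where \<gamma>: "right_triangle_mor X S (f, g, h) (f', g'', h'') (\<alpha>, \<beta>, \<gamma>)"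
    using right_triangulated_mor[OF right_triangulated_X r r'' _ \<beta> eq] by blast
  then have \<gamma>H: "\<gamma> \<in> Hom X (Cod X g) (Cod X g'')" and \<gamma>g: "\<gamma> \<cdot>\<^bsub>X\<^esub> g = g'' \<cdot>\<^bsub>X\<^esub> \<beta>"
    and \<gamma>h: "FArr S \<alpha> \<cdot>\<^bsub>X\<^esub> h = h'' \<cdot>\<^bsub>X\<^esub> \<gamma>"
    unfolding right_triangle_mor.simps by blast+
  obtain s where s: "s \<in> Hom X (Dom X h'') (Dom X h')" and sg: "s \<cdot>\<^bsub>X\<^esub> g'' = g'"
    and hs: "h' \<cdot>\<^bsub>X\<^esub> s = \<epsilon> (Cod X h') \<cdot>\<^bsub>X\<^esub> h''"
    using right_to_left[OF r'' l refl refl refl] by blast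
  have H: "g \<in> Hom X (Cod X f) (Cod X g)" "g'' \<in> Hom X (Cod X f') (Cod X g'')"
    "s \<in> Hom X (Cod X g'') (Cod X g')" "h' \<in> Hom X (Cod X g') (Cod X h')"
    "h'' \<in> Hom X (Cod X g'') (FOb S (FOb U (Cod X h')))"
    "\<epsilon> (Cod X h') \<in> Hom X (FOb S (FOb U (Cod X h'))) (Cod X h')"
    "FArr S \<alpha> \<in> Hom X (FOb S (Dom X f)) (FOb S (FOb U (Cod X h')))"
    "h \<in> Hom X (Cod X g) (FOb S (Dom X f))"
    using a a'' s SU.F.FArr_in_Hom[OF \<alpha>] unfolding Hom_iff by simp_all
  have "s \<cdot>\<^bsub>X\<^esub> \<gamma> \<cdot>\<^bsub>X\<^esub> g = s \<cdot>\<^bsub>X\<^esub> (g'' \<cdot>\<^bsub>X\<^esub> \<beta>)" using X.Comp_assoc[OF H(1) \<gamma>H H(3)] \<gamma>g by simp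
  also have "\<dots> = g' \<cdot>\<^bsub>X\<^esub> \<beta>" using X.Comp_assoc[OF \<beta> H(2,3)] sg by simp
  finally have 1: "s \<cdot>\<^bsub>X\<^esub> \<gamma> \<cdot>\<^bsub>X\<^esub> g = g' \<cdot>\<^bsub>X\<^esub> \<beta>" .
  have "h' \<cdot>\<^bsub>X\<^esub> (s \<cdot>\<^bsub>X\<^esub> \<gamma>) = \<epsilon> (Cod X h') \<cdot>\<^bsub>X\<^esub> h'' \<cdot>\<^bsub>X\<^esub> \<gamma>"
    using X.Comp_assoc[OF \<gamma>H H(3,4)] hs by simp
  also have "\<dots> = \<epsilon> (Cod X h') \<cdot>\<^bsub>X\<^esub> (FArr S \<alpha> \<cdot>\<^bsub>X\<^esub> h)" using X.Comp_assoc[OF \<gamma>H H(5,6)] \<gamma>h by simp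
  also have "\<dots> = \<epsilon> (Cod X h') \<cdot>\<^bsub>X\<^esub> FArr S \<alpha> \<cdot>\<^bsub>X\<^esub> h" using X.Comp_assoc[OF H(8,7,6)] by simp
  finally show ?thesis using 1 X.Comp_in_Hom[OF \<gamma>H H(3)] by blast
qed

text \<open>Dually, the filler factors through a left triangle \<open>(f'', g'', h)\<close> on the arrow \<open>h\<close>.\<close>

lemma left_to_right_fill:
  assumes r: "(f, g, h) \<in> \<R>\<^sub>X" and l: "(f', g', h') \<in> \<L>\<^sub>X"
    and \<alpha>: "\<alpha> \<in> Hom X (FOb S (Dom X f)) (Cod X h')" and \<beta>: "\<beta> \<in> Hom X (Cod X g) (Cod X g')"
    and eq: "h' \<cdot>\<^bsub>X\<^esub> \<beta> = \<alpha> \<cdot>\<^bsub>X\<^esub> h"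
  shows "\<exists>\<delta> \<in> Hom X (Cod X f) (Cod X f').
    \<delta> \<cdot>\<^bsub>X\<^esub> f = f' \<cdot>\<^bsub>X\<^esub> FArr U \<alpha> \<cdot>\<^bsub>X\<^esub> \<eta> (Dom X f) \<and> g' \<cdot>\<^bsub>X\<^esub> \<delta> = \<beta> \<cdot>\<^bsub>X\<^esub> g"
proof -
  interpret X: left_triangulated X U \<L>\<^sub>X by (rule left_triangulated_X)
  interpret SU: adjunction X X S U \<eta> \<epsilon> by (rule adjoint_pair)
  note a = X.left_triangles[OF l, unfolded left_triangle.simps]
    right_triangulated_triangle[OF right_triangulated_X r, unfolded right_triangle.simps]
    \<alpha>[unfolded Hom_iff] \<beta>[unfolded Hom_iff]
  obtain f'' g'' where l'': "(f'', g'', h) \<in> \<L>\<^sub>X" using X.LT1_ex[of h] a by blast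
  note a'' = X.left_triangles[OF l'', unfolded left_triangle.simps]
  have "\<beta> \<in> Hom X (Dom X h) (Dom X h')" "\<alpha> \<in> Hom X (Cod X h) (Cod X h')" using \<alpha> \<beta> a by simp_all
  then obtain \<gamma> where \<gamma>: "left_triangle_mor X U (f'', g'', h) (f', g', h') (\<gamma>, \<beta>, \<alpha>)"
    using X.LT3[OF l'' l _ _ eq[symmetric]] by blast
  then have \<gamma>H: "\<gamma> \<in> Hom X (Dom X g'') (Dom X g')" and \<gamma>f: "\<gamma> \<cdot>\<^bsub>X\<^esub> f'' = f' \<cdot>\<^bsub>X\<^esub> FArr U \<alpha>"
    and \<gamma>g: "\<beta> \<cdot>\<^bsub>X\<^esub> g'' = g' \<cdot>\<^bsub>X\<^esub> \<gamma>"
    unfolding left_triangle_mor.simps by blast+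
  obtain t where t: "t \<in> Hom X (Cod X f) (Cod X f'')" and tf: "t \<cdot>\<^bsub>X\<^esub> f = f'' \<cdot>\<^bsub>X\<^esub> \<eta> (Dom X f)"
    and gt: "g'' \<cdot>\<^bsub>X\<^esub> t = g"
    using left_to_right[OF r l'' refl refl refl] by blast
  have ob: "Dom X f \<in> Ob X" using a by simp
  have H: "f \<in> Hom X (Dom X f) (Cod X f)" "f'' \<in> Hom X (FOb U (FOb S (Dom X f))) (Cod X f'')"
    "\<gamma> \<in> Hom X (Cod X f'') (Cod X f')" "g' \<in> Hom X (Cod X f') (Cod X g')"
    "g'' \<in> Hom X (Cod X f'') (Cod X g)"
    "\<eta> (Dom X f) \<in> Hom X (Dom X f) (FOb U (FOb S (Dom X f)))"
    using a a'' \<gamma>H ob unfolding Hom_iff by simp_all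
  have "\<gamma> \<cdot>\<^bsub>X\<^esub> t \<cdot>\<^bsub>X\<^esub> f = \<gamma> \<cdot>\<^bsub>X\<^esub> (f'' \<cdot>\<^bsub>X\<^esub> \<eta> (Dom X f))" using X.Comp_assoc[OF H(1) t H(3)] tf by simp
  also have "\<dots> = f' \<cdot>\<^bsub>X\<^esub> FArr U \<alpha> \<cdot>\<^bsub>X\<^esub> \<eta> (Dom X f)" using X.Comp_assoc[OF H(6,2,3)] \<gamma>f by simp
  finally have 1: "\<gamma> \<cdot>\<^bsub>X\<^esub> t \<cdot>\<^bsub>X\<^esub> f = f' \<cdot>\<^bsub>X\<^esub> FArr U \<alpha> \<cdot>\<^bsub>X\<^esub> \<eta> (Dom X f)" .
  have "g' \<cdot>\<^bsub>X\<^esub> (\<gamma> \<cdot>\<^bsub>X\<^esub> t) = \<beta> \<cdot>\<^bsub>X\<^esub> g'' \<cdot>\<^bsub>X\<^esub> t" using X.Comp_assoc[OF t H(3,4)] \<gamma>g by simp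
  also have "\<dots> = \<beta> \<cdot>\<^bsub>X\<^esub> g" using X.Comp_assoc[OF t H(5) \<beta>] gt by simp
  finally show ?thesis using 1 X.Comp_in_Hom[OF t H(3)] by blast
qed

end

theorem theoremA:
  fixes C\<^sub>1 :: "('o1, 'm1) cat" and \<Omega> :: "('o1, 'm1, 'o1, 'm1) cat_fun" and \<L> :: "'m1 tri set"
    and X :: "('x, 'p) cat"
    and C\<^sub>2 :: "('o2, 'm2) cat" and \<Sigma> :: "('o2, 'm2, 'o2, 'm2) cat_fun" and \<R> :: "'m2 tri set"
    and i :: "('x, 'p, 'o1, 'm1) cat_fun" and Q :: "('o1, 'm1, 'x, 'p) cat_fun"
    and \<eta>\<^sub>i :: "'x \<Rightarrow> 'p" and \<epsilon>\<^sub>i :: "'o1 \<Rightarrow> 'm1"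
    and j :: "('x, 'p, 'o2, 'm2) cat_fun" and R :: "('o2, 'm2, 'x, 'p) cat_fun"
    and \<rho> :: "'o2 \<Rightarrow> 'm2" and \<theta> :: "'x \<Rightarrow> 'p"
    and \<eta> \<epsilon> :: "'x \<Rightarrow> 'p"
  assumes "prile C\<^sub>1 \<Omega> \<L> X C\<^sub>2 \<Sigma> \<R> i Q \<eta>\<^sub>i \<epsilon>\<^sub>i j R \<rho> \<theta> \<eta> \<epsilon>"
  shows "pretriangulated X (R \<circ>\<^sub>F \<Sigma> \<circ>\<^sub>F j) (Q \<circ>\<^sub>F \<Omega> \<circ>\<^sub>F i)
    (induced_left_triangles \<Omega> \<L> X i Q \<eta>\<^sub>i) (induced_right_triangles \<Sigma> \<R> X j R \<theta>) \<eta> \<epsilon>"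
proof -
  interpret prile C\<^sub>1 \<Omega> \<L> X C\<^sub>2 \<Sigma> \<R> i Q \<eta>\<^sub>i \<epsilon>\<^sub>i j R \<rho> \<theta> \<eta> \<epsilon> by fact
  show ?thesis
    by (rule pretriangulated.intro)
      (fact adjoint_pair left_triangulated_X right_triangulated_X right_to_left_fill left_to_right_fill)+
qed

end
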